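(* Let $M$ be a compact connected boundaryless smooth manifold and let $m$ be Lebesgue measure (a fixed volume probability) on $M$. For a generic homeomorphism $f$ of $M$, i.e. for every $f$ in some residual subset of $\mathrm{Homeo}(M)$, the Birkhoff averages $$\frac{1}{n}\sum_{k=0}^{n-1}\varphi(f^k(x))$$ of every continuous $\varphi: M\to\mathbb{R}$ converge as $n\to\infty$ for $m$-almost every $x\in M$.
   Context: $\mathrm{Homeo}(M)$ is the space of all homeomorphisms of $M$ to itself with the $C^0$ topology, induced by the metric $d_{C^0}(f,g)=\sup_{x\in M} d(f(x),g(x))$, where $d$ is a fixed distance on $M$ inducing its topology. A subset of a topological space $X$ is residual if it contains the intersection of a countable family of open and dense subsets of $X$. A volume probability is a probability measure on the Borel sets of $M$ given by a smooth positive density. *)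

theory Defs
  imports "HOL-Probability.Probability"
begin

text \<open>Throughout, the manifold is the type \<open>'a\<close>; its class instance supplies both the
  topology and the fixed distance \<open>d\<close> inducing it.\<close>

text \<open>For open \<open>S\<close> in finite dimensions only: existence and continuity of the iterated derivatives is
  tested along constant directions.\<close>

primrec Ck_on :: "nat \<Rightarrow> 'e::real_normed_vector set \<Rightarrow> ('e \<Rightarrow> 'f::real_normed_vector) \<Rightarrow> bool" where
  "Ck_on 0 S f \<longleftrightarrow> continuous_on S f"
| "Ck_on (Suc k) S f \<longleftrightarrow>
     (\<forall>x\<in>S. f differentiable (at x)) \<and> (\<forall>v. Ck_on k S (\<lambda>x. frechet_derivative f (at x) v))"

definition smooth_on :: "'e::real_normed_vector set \<Rightarrow> ('e \<Rightarrow> 'f::real_normed_vector) \<Rightarrow> bool" where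
  "smooth_on S f \<longleftrightarrow> (\<forall>k. Ck_on k S f)"


type_synonym ('a, 'e) chart = "'a set \<times> ('a \<Rightarrow> 'e)"

definition smooth_atlas :: "('a::metric_space, 'e::euclidean_space) chart set \<Rightarrow> bool" where
  "smooth_atlas A \<longleftrightarrow>
     (\<Union>(U, \<phi>)\<in>A. U) = UNIV \<and>
     (\<forall>(U, \<phi>)\<in>A. open U \<and> open (\<phi> ` U) \<and> (\<exists>\<psi>. homeomorphism U (\<phi> ` U) \<phi> \<psi>)) \<and>
     (\<forall>(U, \<phi>)\<in>A. \<forall>(V, \<psi>)\<in>A. smooth_on (\<phi> ` (U \<inter> V)) (\<psi> \<circ> inv_into U \<phi>))"

text \<open>The class \<^class>\<open>euclidean_space\<close> excludes dimension 0. A 0-dimensional manifold is a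
  discrete space, with no further smooth structure, so that case is described directly (\<open>A\<close> is then
  ignored). It is disjoint from the other one, because a space with an atlas modelled on a
  \<^class>\<open>euclidean_space\<close> has no isolated points.\<close>

definition smooth_manifold :: "('a::metric_space, 'e::euclidean_space) chart set \<Rightarrow> bool" where
  "smooth_manifold A \<longleftrightarrow> (\<forall>x::'a. open {x}) \<or> smooth_atlas A"

definition smooth_positive_density ::
    "('a::metric_space, 'e::euclidean_space) chart set \<Rightarrow> 'a measure \<Rightarrow> bool" where
  "smooth_positive_density A m \<longleftrightarrow>
     (if \<forall>x::'a. open {x} then (\<forall>x. measure m {x} > 0)
      else \<forall>(U, \<phi>)\<in>A. \<exists>\<rho>::'e \<Rightarrow> real.
        smooth_on (\<phi> ` U) \<rho> \<and> (\<forall>y\<in>\<phi> ` U. \<rho> y > 0) \<and>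
        (\<forall>B\<in>sets borel. B \<subseteq> U \<longrightarrow> emeasure m B = (\<integral>\<^sup>+y\<in>\<phi> ` B. ennreal (\<rho> y) \<partial>lborel)))"

definition volume_probability ::
    "('a::metric_space, 'e::euclidean_space) chart set \<Rightarrow> 'a measure \<Rightarrow> bool" where
  "volume_probability A m \<longleftrightarrow> prob_space m \<and> sets m = sets borel \<and> smooth_positive_density A m"


definition Homeo :: "('a::metric_space \<Rightarrow> 'a) set" where
  "Homeo = {f. \<exists>g. homeomorphism UNIV UNIV f g}"

definition C0_dist :: "('a::metric_space \<Rightarrow> 'a) \<Rightarrow> ('a \<Rightarrow> 'a) \<Rightarrow> real" where
  "C0_dist f g = (SUP x. dist (f x) (g x))"

definition Homeo_topology :: "('a::metric_space \<Rightarrow> 'a) topology" where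
  "Homeo_topology = Metric_space.mtopology Homeo C0_dist"

lemma C0_dist_upper:
  assumes "compact (UNIV :: 'a::metric_space set)"
  shows "dist (f x) (g x) \<le> C0_dist f (g :: 'a \<Rightarrow> 'a)"
  unfolding C0_dist_def
proof (rule cSUP_upper)
  obtain e where "\<And>x y :: 'a. dist x y \<le> e"
    using compact_imp_bounded[OF assms] by (auto simp: bounded_two_points)
  then show "bdd_above (range (\<lambda>x. dist (f x) (g x)))"
    by (intro bdd_aboveI2)
qed simp

lemma Metric_space_Homeo:
  assumes "compact (UNIV :: 'a::metric_space set)"
  shows "Metric_space (Homeo :: ('a \<Rightarrow> 'a) set) C0_dist"
proof
  fix f g h :: "'a \<Rightarrow> 'a"
  note up = C0_dist_upper[OF assms]
  show "0 \<le> C0_dist f g"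
    using order_trans[OF zero_le_dist up] .
  show "C0_dist f g = C0_dist g f"
    by (simp add: C0_dist_def dist_commute)
  show "C0_dist f g = 0 \<longleftrightarrow> f = g"
  proof
    assume "C0_dist f g = 0"
    then show "f = g"
      using up[of f _ g] by (intro ext) simp
  qed (simp add: C0_dist_def)
  show "C0_dist f h \<le> C0_dist f g + C0_dist g h"
    unfolding C0_dist_def[of f h]
  proof (rule cSUP_least)
    fix x
    show "dist (f x) (h x) \<le> C0_dist f g + C0_dist g h"
      using dist_triangle[of "f x" "h x" "g x"] up[of f x g] up[of g x h] by linarith
  qed simp
qed

lemma topspace_Homeo_topology:
  assumes "compact (UNIV :: 'a::metric_space set)"
  shows "topspace (Homeo_topology :: ('a \<Rightarrow> 'a) topology) = Homeo"
  by (simp add: Homeo_topology_def Metric_space.topspace_mtopology[OF Metric_space_Homeo[OF assms]])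

definition residual_in :: "'b topology \<Rightarrow> 'b set \<Rightarrow> bool" where
  "residual_in X R \<longleftrightarrow> R \<subseteq> topspace X \<and>
     (\<exists>\<U>. countable \<U> \<and> (\<forall>U\<in>\<U>. openin X U \<and> X closure_of U = topspace X) \<and>
          topspace X \<inter> \<Inter>\<U> \<subseteq> R)"

end

theory Submission
  imports Defs
begin

text \<open>A point is \<open>\<epsilon>\<close>-trapped if its orbit enters a set that some iterate maps well inside itself and
  whose intermediate images have diameter below \<open>\<epsilon>\<close>; its orbit then shadows an eventually periodic
  one, so a point that is \<open>\<epsilon>\<close>-trapped for every \<open>\<epsilon>\<close> has convergent Birkhoff averages. Being trapped is
  an open condition on map and point, so it suffices to perturb \<open>f\<close> until all points outside a set of
  small measure are trapped. A given finite set of points can be trapped by closing their orbits one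
  after the other. Taking these points to be the centres of finitely many disjoint small cells that
  fill up most of \<open>M\<close> (Vitali), conjugate the perturbed map with a homeomorphism that squeezes most of
  each cell into the trapped neighbourhood of its centre: the cells are small, so this moves the map
  only a little.\<close>

section \<open>Trapping\<close>

text \<open>\<open>f\<close> need not preserve \<open>m\<close>, so Birkhoff's theorem gives nothing
  here; convergence comes from topology, and the density of \<open>m\<close> serves to know that
  coordinate-null sets are null. Closing orbits handles finitely many points at a time and gives no
  control over the size of the trapped neighbourhoods it produces. Hence the cells are fixed
  beforehand, their size dictated by the modulus of continuity of \<open>f\<close>, and a cell has
  to be compressible into an arbitrarily small neighbourhood of its centre: the squeezing map moves
  points by less than the diameter of the cells, however small the trapped set turns out to be.
  Squeezing is done by conjugation because this carries traps to traps, so that the squeezed points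
  stay trapped along their whole orbits. Since trapping does not mention \<phi>, the residual set
  and the exceptional null set serve all continuous \<phi> at once.\<close>

definition trapped :: "real \<Rightarrow> ('a::metric_space \<Rightarrow> 'a) \<Rightarrow> 'a \<Rightarrow> bool" where
  "trapped \<epsilon> f x \<longleftrightarrow> (\<exists>V n T \<eta>. 0 < \<eta> \<and> 0 < T \<and> ball ((f ^^ n) x) \<eta> \<subseteq> V \<and>
     (\<forall>v\<in>V. ball ((f ^^ T) v) \<eta> \<subseteq> V) \<and>
     (\<forall>j<T. \<forall>v\<in>V. \<forall>w\<in>V. dist ((f ^^ j) v) ((f ^^ j) w) + \<eta> \<le> \<epsilon>))"

lemma trappedE:
  assumes "trapped \<epsilon> f x"
  obtains V n T \<eta> where "0 < \<eta>" "0 < T" "ball ((f ^^ n) x) \<eta> \<subseteq> V"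
    "\<And>v. v \<in> V \<Longrightarrow> ball ((f ^^ T) v) \<eta> \<subseteq> V"
    "\<And>j v w. j < T \<Longrightarrow> v \<in> V \<Longrightarrow> w \<in> V \<Longrightarrow> dist ((f ^^ j) v) ((f ^^ j) w) + \<eta> \<le> \<epsilon>"
proof -
  from assms[unfolded trapped_def] obtain V n T \<eta> where
    "0 < \<eta> \<and> 0 < T \<and> ball ((f ^^ n) x) \<eta> \<subseteq> V \<and>
     (\<forall>v\<in>V. ball ((f ^^ T) v) \<eta> \<subseteq> V) \<and>
     (\<forall>j<T. \<forall>v\<in>V. \<forall>w\<in>V. dist ((f ^^ j) v) ((f ^^ j) w) + \<eta> \<le> \<epsilon>)"
    by (elim exE)
  then show thesis by (intro that[of \<eta> T n V]) simp_all
qed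

lemma trappedI:
  assumes "0 < \<eta>" "0 < T" "ball ((f ^^ n) x) \<eta> \<subseteq> V"
    "\<And>v. v \<in> V \<Longrightarrow> ball ((f ^^ T) v) \<eta> \<subseteq> V"
    "\<And>j v w. j < T \<Longrightarrow> v \<in> V \<Longrightarrow> w \<in> V \<Longrightarrow> dist ((f ^^ j) v) ((f ^^ j) w) + \<eta> \<le> \<epsilon>"
  shows "trapped \<epsilon> f x"
  unfolding trapped_def
  by (rule exI[of _ V], rule exI[of _ n], rule exI[of _ T], rule exI[of _ \<eta>]) (use assms in simp)

lemma C0_dist_le:
  assumes "\<And>x. dist (f x) (g x) \<le> r"
  shows "C0_dist f g \<le> r"
  unfolding C0_dist_def using assms by (intro cSUP_least) auto

text \<open>Induction on \<open>n\<close> with the accuracy \<eta> left general. Only the modulus of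
  continuity of \<open>f\<close> enters, so one \<open>r\<close> serves all maps \<open>g\<close>
  and all base points.\<close>

lemma funpow_C0_close:
  fixes f :: "'a::metric_space \<Rightarrow> 'a"
  assumes cpt: "compact (UNIV :: 'a set)" and f: "continuous_on UNIV f" and "0 < \<eta>"
  shows "\<exists>r>0. \<forall>(g::'a \<Rightarrow> 'a) (x::'a) y. C0_dist f g < r \<and> dist x y < r \<longrightarrow> dist ((f ^^ n) x) ((g ^^ n) y) < \<eta>"
  using \<open>0 < \<eta>\<close>
proof (induction n arbitrary: \<eta>)
  case (Suc n)
  from compact_uniformly_continuous[OF f cpt] Suc.prems
  obtain d where "0 < d" and d: "\<And>x y. dist x y < d \<Longrightarrow> dist (f x) (f y) < \<eta> / 2"
    unfolding uniformly_continuous_on_def by (metis UNIV_I half_gt_zero dist_commute)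
  from Suc.IH[OF \<open>0 < d\<close>] obtain r where "0 < r"
    and r: "\<And>g x y. C0_dist f g < r \<Longrightarrow> dist x y < r \<Longrightarrow> dist ((f ^^ n) x) ((g ^^ n) y) < d"
    by blast
  show ?case
  proof (intro exI[of _ "min r (\<eta> / 2)"] conjI allI impI)
    fix g :: "'a \<Rightarrow> 'a" and x y :: 'a assume *: "C0_dist f g < min r (\<eta> / 2) \<and> dist x y < min r (\<eta> / 2)"
    let ?u = "(f ^^ n) x" and ?v = "(g ^^ n) y"
    have "dist (f ?u) (f ?v) < \<eta> / 2"
      using d r * by simp
    moreover have "dist (f ?v) (g ?v) < \<eta> / 2"
      using C0_dist_upper[OF cpt, of f ?v g] * by simp
    ultimately show "dist ((f ^^ Suc n) x) ((g ^^ Suc n) y) < \<eta>"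
      using dist_triangle_less_add[of "f ?u" "f ?v" "\<eta> / 2" "g ?v" "\<eta> / 2"]
      by (simp add: dist_commute)
  qed (use \<open>0 < r\<close> Suc.prems in simp)
qed auto

text \<open>This is what the slack \<eta> in \<open>trapped\<close> is for. The same
  \<open>V\<close>, \<open>n\<close>, \<open>T\<close> work for \<open>g\<close> with slack
  \<open>\<eta> / 2\<close>: if all relevant iterates move by less than \<open>\<eta> / 4\<close>,
  the ball inclusions lose one such error and the diameter bound loses two. Finitely many iterates,
  up to \<open>max n T\<close>, have to be controlled.\<close>

lemma trapped_open:
  fixes f :: "'a::metric_space \<Rightarrow> 'a"
  assumes cpt: "compact (UNIV :: 'a set)" and f: "continuous_on UNIV f" and "trapped \<epsilon> f x"
  shows "\<exists>r>0. \<forall>(g::'a \<Rightarrow> 'a) (y::'a). C0_dist f g < r \<and> dist x y < r \<longrightarrow> trapped \<epsilon> g y"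
proof -
  obtain V n T \<eta> where "0 < \<eta>" "0 < T" and n: "ball ((f ^^ n) x) \<eta> \<subseteq> V"
    and T: "\<And>v. v \<in> V \<Longrightarrow> ball ((f ^^ T) v) \<eta> \<subseteq> V"
    and j: "\<And>j v w. j < T \<Longrightarrow> v \<in> V \<Longrightarrow> w \<in> V \<Longrightarrow> dist ((f ^^ j) v) ((f ^^ j) w) + \<eta> \<le> \<epsilon>"
    by (rule trappedE[OF assms(3)]) (rule that)
  have "\<forall>k. \<exists>r>0. \<forall>(g::'a \<Rightarrow> 'a) (x::'a) y. C0_dist f g < r \<and> dist x y < r \<longrightarrow> dist ((f ^^ k) x) ((g ^^ k) y) < \<eta> / 4"
    using funpow_C0_close[OF cpt f, of "\<eta> / 4"] \<open>0 < \<eta>\<close> by simp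
  then obtain r where r0: "\<And>k. 0 < r k"
    and r: "\<And>k g x y. C0_dist f g < r k \<Longrightarrow> dist x y < r k \<Longrightarrow> dist ((f ^^ k) x) ((g ^^ k) y) < \<eta> / 4"
    by metis
  define s where "s = Min (r ` {..max n T})"
  have s: "0 < s" "\<And>k. k \<le> max n T \<Longrightarrow> s \<le> r k"
    unfolding s_def using r0 by (auto simp: Min_gr_iff)
  have close: "dist ((f ^^ k) y) ((g ^^ k) z) < \<eta> / 4"
    if "C0_dist f g < s" "dist y z < s" "k \<le> max n T" for g k y z
    using r[of g k y z] s(2)[of k] that by simp
  have ball: "ball u (\<eta> / 2) \<subseteq> ball w \<eta>" if "dist w u < \<eta> / 4" for u w :: 'a
    using that \<open>0 < \<eta>\<close> dist_triangle_less_add[of w u "\<eta> / 4" _ "\<eta> / 2"]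
    by (force simp: dist_commute)
  show ?thesis
  proof (intro exI[of _ s] conjI allI impI)
    fix g :: "'a \<Rightarrow> 'a" and y :: 'a assume *: "C0_dist f g < s \<and> dist x y < s"
    show "trapped \<epsilon> g y"
    proof (rule trappedI[where \<eta> = "\<eta> / 2" and T = T and n = n and V = V])
      show "ball ((g ^^ n) y) (\<eta> / 2) \<subseteq> V"
        using n ball[OF close[of g x y n]] * by auto
      show "ball ((g ^^ T) v) (\<eta> / 2) \<subseteq> V" if "v \<in> V" for v
        using T[OF that] ball[OF close[of g v v T]] * s(1) by auto
      show "dist ((g ^^ i) v) ((g ^^ i) w) + \<eta> / 2 \<le> \<epsilon>" if "i < T" "v \<in> V" "w \<in> V" for i v w
      proof -
        have "dist ((f ^^ i) v) ((g ^^ i) v) < \<eta> / 4" "dist ((f ^^ i) w) ((g ^^ i) w) < \<eta> / 4"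
          using close * s(1) that(1) by auto
        moreover have "dist ((g ^^ i) v) ((g ^^ i) w) \<le> dist ((f ^^ i) v) ((g ^^ i) v) +
            dist ((f ^^ i) v) ((f ^^ i) w) + dist ((f ^^ i) w) ((g ^^ i) w)"
          by metric
        ultimately show ?thesis using j[OF that] by linarith
      qed
    qed (use \<open>0 < \<eta>\<close> \<open>0 < T\<close> in simp_all)
  qed (use s(1) in simp)
qed

lemma C0_dist_self [simp]: "C0_dist f f = 0"
  by (simp add: C0_dist_def)

lemma open_trapped:
  fixes f :: "'a::metric_space \<Rightarrow> 'a"
  assumes "compact (UNIV :: 'a set)" and "continuous_on UNIV f"
  shows "open {x. trapped \<epsilon> f x}"
  unfolding open_dist
proof (intro ballI, unfold mem_Collect_eq)
  fix x assume "trapped \<epsilon> f x"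
  from trapped_open[OF assms this] obtain r where "0 < r"
    "\<forall>g y. C0_dist f g < r \<and> dist x y < r \<longrightarrow> trapped \<epsilon> g y" by blast
  then show "\<exists>e>0. \<forall>y. dist y x < e \<longrightarrow> trapped \<epsilon> f y"
    by (intro exI[of _ r]) (auto simp: dist_commute)
qed

text \<open>The preimage of the trap under \<open>h\<close> is a trap for the conjugate. Uniform
  continuity of \<open>h\<close> supplies the new slack, and \<open>k\<close> moves each of two
  points by at most \<delta>, which costs \<open>2 * \<delta>\<close> in diameter.\<close>

lemma trapped_conjugate:
  fixes f h k :: "'a::metric_space \<Rightarrow> 'a"
  assumes cpt: "compact (UNIV :: 'a set)" and hk: "homeomorphism UNIV UNIV h k"
    and close: "\<And>x. dist x (k x) \<le> \<delta>" and tr: "trapped \<epsilon> f (h x)"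
  shows "trapped (\<epsilon> + 2 * \<delta>) (k \<circ> f \<circ> h) x"
proof -
  obtain V n T \<eta> where "0 < \<eta>" "0 < T" and n: "ball ((f ^^ n) (h x)) \<eta> \<subseteq> V"
    and T: "\<And>v. v \<in> V \<Longrightarrow> ball ((f ^^ T) v) \<eta> \<subseteq> V"
    and j: "\<And>j v w. j < T \<Longrightarrow> v \<in> V \<Longrightarrow> w \<in> V \<Longrightarrow> dist ((f ^^ j) v) ((f ^^ j) w) + \<eta> \<le> \<epsilon>"
    by (rule trappedE[OF tr]) (rule that)
  have hk': "h (k y) = y" "k (h y) = y" for y
    using hk by (auto simp: homeomorphism_def)
  have pow: "((k \<circ> f \<circ> h) ^^ i) y = k ((f ^^ i) (h y))" for i y
    by (induction i) (simp_all add: hk')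
  have "uniformly_continuous_on UNIV h"
    using hk cpt by (auto intro: compact_uniformly_continuous simp: homeomorphism_def)
  then obtain d where "0 < d" and d: "\<And>y z. dist y z < d \<Longrightarrow> dist (h y) (h z) < \<eta>"
    unfolding uniformly_continuous_on_def using \<open>0 < \<eta>\<close> by (metis UNIV_I dist_commute)
  have ball: "ball (k u) (min d \<eta>) \<subseteq> h -` V" if "ball u \<eta> \<subseteq> V" for u
    using that d[of "k u"] by (force simp: hk')
  show ?thesis
  proof (rule trappedI[where \<eta> = "min d \<eta>" and T = T and n = n and V = "h -` V"], unfold pow)
    fix i v w assume "i < T" "v \<in> h -` V" "w \<in> h -` V"
    then have fvw: "dist ((f ^^ i) (h v)) ((f ^^ i) (h w)) + \<eta> \<le> \<epsilon>" using j by simp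
    have "dist (k y) (k z) \<le> dist y z + 2 * \<delta>" for y z
      using close[of y] close[of z] dist_triangle[of "k y" "k z" y] dist_triangle[of y "k z" z]
      by (simp add: dist_commute)
    from this[of "(f ^^ i) (h v)" "(f ^^ i) (h w)"] fvw
    show "dist (k ((f ^^ i) (h v))) (k ((f ^^ i) (h w))) + min d \<eta> \<le> \<epsilon> + 2 * \<delta>"
      by linarith
  qed (use \<open>0 < \<eta>\<close> \<open>0 < d\<close> \<open>0 < T\<close> n T ball in auto)
qed

section \<open>Birkhoff averages of trapped points\<close>

text \<open>With \<open>c\<close> the mean over one period, \<open>s N\<close>, the
  \<open>N\<close>-th partial sum minus \<open>N * c\<close>, is itself eventually periodic, hence
  bounded; dividing by \<open>N\<close> sends it to 0.\<close>

lemma convergent_average_eventually_periodic: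
  fixes b :: "nat \<Rightarrow> real"
  assumes "0 < T" and per: "\<And>k. n \<le> k \<Longrightarrow> b (k + T) = b k"
  shows "convergent (\<lambda>N. (1 / real N) * (\<Sum>k<N. b k))"
proof -
  define c where "c = (\<Sum>k=n..<n+T. b k) / real T"
  define s where "s N = (\<Sum>k<N. b k) - real N * c" for N
  have window: "(\<Sum>k=N..<N+T. b k) = real T * c" if "n \<le> N" for N
    using that
  proof (induction N rule: dec_induct)
    case (step N)
    have "(\<Sum>k=N..<N+T. b k) + b (N + T) = b N + (\<Sum>k=Suc N..<Suc N+T. b k)"
      using sum.atLeast_Suc_lessThan[of N "Suc N + T" b] sum.atLeastLessThan_Suc[of N "N + T" b] by simp
    then show ?case using step per[of N] by simp
  qed (use \<open>0 < T\<close> in \<open>simp add: c_def\<close>)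
  have s_per: "s (N + T) = s N" if "n \<le> N" for N
  proof -
    have "(\<Sum>k<N+T. b k) = (\<Sum>k<N. b k) + (\<Sum>k=N..<N+T. b k)"
      using sum.atLeastLessThan_concat[of 0 N "N + T" b] by (simp add: lessThan_atLeast0)
    then show ?thesis by (simp add: s_def window[OF that] algebra_simps)
  qed
  define B where "B = (\<Sum>k<n+T. \<bar>s k\<bar>)"
  have "\<bar>s N\<bar> \<le> B" for N
  proof (induction N rule: less_induct)
    case (less N)
    show ?case
    proof (cases "N < n + T")
      case True
      then show ?thesis unfolding B_def by (intro member_le_sum) auto
    next
      case False
      then show ?thesis using s_per[of "N - T"] less[of "N - T"] \<open>0 < T\<close> by simp
    qed
  qed
  then have "norm ((1 / real N) * s N) \<le> (1 / real N) * B" for N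
    by (simp add: abs_mult divide_right_mono)
  then have "\<forall>\<^sub>F N in sequentially. norm ((1 / real N) * s N) \<le> (1 / real N) * B"
    by simp
  then have "(\<lambda>N. (1 / real N) * s N) \<longlonglongrightarrow> 0"
    by (rule Lim_null_comparison) (intro tendsto_mult_left_zero lim_1_over_n)
  then have "(\<lambda>N. (1 / real N) * s N + c) \<longlonglongrightarrow> 0 + c"
    by (intro tendsto_intros)
  moreover have "\<forall>\<^sub>F N in sequentially. (1 / real N) * s N + c = (1 / real N) * (\<Sum>k<N. b k)"
    using eventually_gt_at_top[of 0] by eventually_elim (simp add: s_def field_simps)
  ultimately show ?thesis
    by (rule convergentI[OF Lim_transform_eventually])
qed

text \<open>Averaging does not increase the sup distance, so the averages of \<open>a\<close>
  inherit the Cauchy property from those of \<open>b\<close>; three errors of size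
  \<open>e / 4\<close> are spent.\<close>

lemma convergent_average_approx:
  fixes a :: "nat \<Rightarrow> real"
  assumes "\<And>e. 0 < e \<Longrightarrow> \<exists>b. convergent (\<lambda>N. (1 / real N) * (\<Sum>k<N. b k)) \<and> (\<forall>k. \<bar>a k - b k\<bar> \<le> e)"
  shows "convergent (\<lambda>N. (1 / real N) * (\<Sum>k<N. a k))"
proof (rule real_Cauchy_convergent, rule metric_CauchyI)
  fix e :: real assume "0 < e"
  then obtain b where b: "convergent (\<lambda>N. (1 / real N) * (\<Sum>k<N. b k))"
    and ab: "\<And>k. \<bar>a k - b k\<bar> \<le> e / 4"
    using assms[of "e / 4"] by auto
  let ?A = "\<lambda>a N. (1 / real N) * (\<Sum>k<N. a k)"
  have close: "\<bar>?A a N - ?A b N\<bar> \<le> e / 4" for N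
  proof (cases "N = 0")
    case False
    have "\<bar>\<Sum>k<N. a k - b k\<bar> \<le> (\<Sum>k<N. e / 4)"
      using ab by (intro order_trans[OF sum_abs] sum_mono)
    then have "\<bar>(\<Sum>k<N. a k) - (\<Sum>k<N. b k)\<bar> \<le> real N * (e / 4)"
      by (simp add: sum_subtractf)
    moreover have "?A a N - ?A b N = ((\<Sum>k<N. a k) - (\<Sum>k<N. b k)) / real N"
      using False by (simp add: field_simps)
    ultimately show ?thesis using False
      by (simp add: abs_divide divide_le_eq mult.commute)
  qed (use \<open>0 < e\<close> in simp)
  obtain M where M: "\<And>p q. M \<le> p \<Longrightarrow> M \<le> q \<Longrightarrow> dist (?A b p) (?A b q) < e / 4"
    using metric_CauchyD[OF convergent_Cauchy[OF b], of "e / 4"] \<open>0 < e\<close> by auto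
  have "dist (?A a p) (?A a q) < e" if "M \<le> p" "M \<le> q" for p q
    using M[OF that] close[of p] close[of q] \<open>0 < e\<close> unfolding dist_real_def by linarith
  then show "\<exists>M. \<forall>p\<ge>M. \<forall>q\<ge>M. dist (?A a p) (?A a q) < e" by blast
qed

lemma trapped_imp_convergent_average:
  fixes f :: "'a::metric_space \<Rightarrow> 'a" and \<phi> :: "'a \<Rightarrow> real"
  assumes cpt: "compact (UNIV :: 'a set)" and \<phi>: "continuous_on UNIV \<phi>"
    and tr: "\<And>k. trapped (1 / real (Suc k)) f x"
  shows "convergent (\<lambda>n. (1 / real n) * (\<Sum>k<n. \<phi> ((f ^^ k) x)))"
proof (rule convergent_average_approx)
  fix e :: real assume "0 < e"
  with compact_uniformly_continuous[OF \<phi> cpt]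
  obtain d where "0 < d" and d: "\<And>y z. dist y z < d \<Longrightarrow> \<bar>\<phi> y - \<phi> z\<bar> < e"
    unfolding uniformly_continuous_on_def by (metis UNIV_I dist_commute dist_real_def)
  obtain i where i: "1 / real (Suc i) < d"
    using \<open>0 < d\<close> nat_approx_posE by blast
  obtain V n T \<eta> where "0 < \<eta>" "0 < T" and n: "ball ((f ^^ n) x) \<eta> \<subseteq> V"
    and T: "\<And>v. v \<in> V \<Longrightarrow> ball ((f ^^ T) v) \<eta> \<subseteq> V"
    and j: "\<And>j v w. j < T \<Longrightarrow> v \<in> V \<Longrightarrow> w \<in> V \<Longrightarrow> dist ((f ^^ j) v) ((f ^^ j) w) + \<eta> \<le> 1 / real (Suc i)"
    by (rule trappedE[OF tr[of i]]) (rule that)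
  have inV: "(f ^^ (q * T + n)) x \<in> V" for q
  proof (induction q)
    case 0
    then show ?case using n \<open>0 < \<eta>\<close> by (simp add: subset_iff)
  next
    case (Suc q)
    have "(f ^^ (Suc q * T + n)) x = (f ^^ T) ((f ^^ (q * T + n)) x)"
      by (simp add: funpow_add add.assoc)
    then show ?case using T[OF Suc] \<open>0 < \<eta>\<close> by (simp add: subset_iff)
  qed
  \<comment> \<open>The orbit up to time \<open>n + T\<close>, its last stretch of length
    \<open>T\<close> then repeated forever. The true orbit at a later time and the repeated point
    are images of two points of \<open>V\<close> under the same iterate of index below
    \<open>T\<close>, so they are close.\<close>
  define b where "b k = (if k < n then \<phi> ((f ^^ k) x) else \<phi> ((f ^^ (n + (k - n) mod T)) x))" for k
  show "\<exists>b. convergent (\<lambda>N. (1 / real N) * (\<Sum>k<N. b k)) \<and> (\<forall>k. \<bar>\<phi> ((f ^^ k) x) - b k\<bar> \<le> e)"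
  proof (intro exI[of _ b] conjI allI)
    show "convergent (\<lambda>N. (1 / real N) * (\<Sum>k<N. b k))"
    proof (rule convergent_average_eventually_periodic[OF \<open>0 < T\<close>])
      show "b (k + T) = b k" if "n \<le> k" for k
        using that by (auto simp: b_def le_iff_add add.assoc)
    qed
    show "\<bar>\<phi> ((f ^^ k) x) - b k\<bar> \<le> e" for k
    proof (cases "k < n")
      case False
      let ?q = "(k - n) div T" and ?r = "(k - n) mod T"
      have "k = ?r + (?q * T + n)" using False by simp
      then have "(f ^^ k) x = (f ^^ ?r) ((f ^^ (?q * T + n)) x)"
        by (metis funpow_add comp_apply)
      moreover have "(f ^^ (n + ?r)) x = (f ^^ ?r) ((f ^^ n) x)"
        by (simp add: funpow_add add.commute[of n])
      ultimately have "dist ((f ^^ k) x) ((f ^^ (n + ?r)) x) + \<eta> \<le> 1 / real (Suc i)"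
        using j[of ?r, OF _ inV[of ?q] inV[of 0]] \<open>0 < T\<close> by simp
      then show ?thesis
        using d[of "(f ^^ k) x" "(f ^^ (n + ?r)) x"] i \<open>0 < \<eta>\<close> False by (simp add: b_def)
    qed (use \<open>0 < e\<close> in \<open>simp add: b_def\<close>)
  qed
qed

section \<open>Cells and the closing of orbits\<close>

text \<open>An abstract substitute for a coordinate ball. If \<open>D\<close> has small diameter,
  the homeomorphism \<open>h\<close> is close to the identity no matter how strongly it compresses
  \<open>K\<close>.\<close>

definition cell :: "'a::metric_space \<Rightarrow> 'a set \<Rightarrow> bool" where
  "cell c D \<longleftrightarrow> open D \<and> c \<in> D \<and>
     (\<forall>K V. compact K \<and> K \<subseteq> D \<and> open V \<and> c \<in> V \<longrightarrow>
       (\<exists>h k. homeomorphism UNIV UNIV h k \<and> (\<forall>y. y \<notin> D \<longrightarrow> h y = y) \<and> h ` K \<subseteq> V))"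

lemma cellE:
  assumes "cell c D" "compact K" "K \<subseteq> D" "open V" "c \<in> V"
  obtains h k where "homeomorphism UNIV UNIV h k" "\<And>y. y \<notin> D \<Longrightarrow> h y = y" "h ` K \<subseteq> V"
proof -
  have "\<exists>h k. homeomorphism UNIV UNIV h k \<and> (\<forall>y. y \<notin> D \<longrightarrow> h y = y) \<and> h ` K \<subseteq> V"
    using assms unfolding cell_def by simp
  then obtain h k where "homeomorphism UNIV UNIV h k" "\<forall>y. y \<notin> D \<longrightarrow> h y = y" "h ` K \<subseteq> V"
    by (elim exE conjE)
  then show thesis by (intro that[of h k]) auto
qed

lemma homeomorphism_support:
  assumes "homeomorphism UNIV UNIV h k" "\<And>y. y \<notin> D \<Longrightarrow> h y = y" "x \<in> D"
  shows "h x \<in> D"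
  using assms unfolding homeomorphism_def by (metis UNIV_I)

text \<open>Two nested sets are needed to close an orbit. The return time of \<open>c\<close> is
  measured with respect to \<open>D0\<close>; only then is the cell \<open>D\<close> chosen, because
  it has to contain the returning point. As \<open>closure D\<close> lies inside \<open>D0\<close>,
  the intermediate iterates of \<open>c\<close> stay away from \<open>closure D\<close>, and so do
  those of all nearby points.\<close>

definition joined_by_cells :: "real \<Rightarrow> 'a::metric_space \<Rightarrow> 'a \<Rightarrow> bool" where
  "joined_by_cells \<eta> c b \<longleftrightarrow>
     (\<exists>D0. open D0 \<and> c \<in> D0 \<and> b \<in> D0 \<and> (\<forall>x\<in>D0. \<forall>y\<in>D0. dist x y < \<eta>) \<and>
       (\<forall>x\<in>D0. \<exists>D. cell c D \<and> x \<in> D \<and> closure D \<subseteq> D0))"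

text \<open>Compactness only tells that two points of an orbit lie near some limit \<open>z\<close>,
  so \<open>c\<close> and \<open>b\<close> must be arbitrary points of \<open>N\<close>.\<close>

definition small_cells_everywhere :: "'a::metric_space itself \<Rightarrow> bool" where
  "small_cells_everywhere _ \<longleftrightarrow> (\<forall>z::'a. \<forall>\<eta>>0. \<exists>N. open N \<and> z \<in> N \<and>
     (\<forall>c\<in>N. \<forall>b\<in>N. joined_by_cells \<eta> c b))"

text \<open>The orbit of \<open>p\<close> nearly returns to one of its points \<open>c\<close>. Squeezing a small cell around \<open>c\<close>
  towards \<open>c\<close> after each application of \<open>f\<close> turns a neighbourhood of \<open>c\<close> into a trap whose period
  is the first return time of \<open>c\<close>.\<close>

lemma trapped_dense:
  fixes f :: "'a::metric_space \<Rightarrow> 'a"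
  assumes cpt: "compact (UNIV :: 'a set)" and cells: "small_cells_everywhere TYPE('a)"
    and f: "f \<in> Homeo" and "0 < \<epsilon>" and "0 < r"
  shows "\<exists>g\<in>Homeo. C0_dist f g < r \<and> trapped \<epsilon> g p"
proof -
  obtain f' where f': "homeomorphism UNIV UNIV f f'"
    using f by (auto simp: Homeo_def)
  then have contf: "continuous_on UNIV f" by (simp add: homeomorphism_def)
  have cont: "continuous_on UNIV (f ^^ j)" for j
  proof (induction j)
    case (Suc j)
    then show ?case using continuous_on_compose[OF Suc, of f] contf
      by (simp add: continuous_on_subset)
  qed (simp add: id_def)
  obtain z l where l: "strict_mono (l :: nat \<Rightarrow> nat)" "(\<lambda>i. (f ^^ l i) p) \<longlonglongrightarrow> z"
    using cpt[unfolded compact_eq_seq_compact_metric seq_compact_def, rule_format, of "\<lambda>i. (f ^^ i) p"]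
    by (auto simp: o_def)
  \<comment> \<open>\<open>C0_dist\<close> is a supremum, so displacements below \<eta> only bound
    it by \<eta>; halving \<open>r\<close> keeps the final inequality strict.\<close>
  define \<eta> where "\<eta> = r / 2"
  have "0 < \<eta>" using \<open>0 < r\<close> by (simp add: \<eta>_def)
  have "\<exists>N. open N \<and> z \<in> N \<and> (\<forall>c\<in>N. \<forall>b\<in>N. joined_by_cells \<eta> c b)"
    using cells \<open>0 < \<eta>\<close> by (simp add: small_cells_everywhere_def)
  then obtain N where "open N" "z \<in> N" and N: "\<forall>c\<in>N. \<forall>b\<in>N. joined_by_cells \<eta> c b"
    by (elim exE conjE)
  have "\<forall>\<^sub>F i in sequentially. (f ^^ l i) p \<in> N"
    using l(2) \<open>open N\<close> \<open>z \<in> N\<close> by (rule topological_tendstoD)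
  then obtain M where M: "\<And>i. M \<le> i \<Longrightarrow> (f ^^ l i) p \<in> N"
    by (auto simp: eventually_sequentially)
  \<comment> \<open>The index \<open>Suc M\<close> instead of \<open>M\<close> makes
    \<open>s\<close> positive, so that \<open>c\<close> is a strictly later point of the orbit of
    \<open>p\<close> and witnesses the entrance time \<open>i0\<close> below.\<close>
  define s where "s = l (Suc M)"
  define t where "t = l (Suc (Suc M))"
  have st: "0 < s" "s < t"
    using seq_suble[OF l(1), of "Suc M"] l(1) by (auto simp: s_def t_def strict_mono_def)
  define c where "c = (f ^^ s) p"
  have b: "(f ^^ (t - s)) c = (f ^^ t) p"
    using st by (simp add: c_def flip: funpow_add comp_apply[of "f ^^ _" "f ^^ _"])
  have "c \<in> N" "(f ^^ (t - s)) c \<in> N"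
    unfolding b using M[of "Suc M"] M[of "Suc (Suc M)"] by (auto simp: c_def s_def t_def)
  with N have "joined_by_cells \<eta> c ((f ^^ (t - s)) c)" by simp
  then obtain D0 where "open D0" "c \<in> D0" "(f ^^ (t - s)) c \<in> D0"
    and D0: "\<forall>x\<in>D0. \<forall>y\<in>D0. dist x y < \<eta>"
    and D0cell: "\<forall>x\<in>D0. \<exists>D. cell c D \<and> x \<in> D \<and> closure D \<subseteq> D0"
    unfolding joined_by_cells_def by (elim exE conjE)
  define T where "T = (LEAST j. 0 < j \<and> (f ^^ j) c \<in> D0)"
  have "0 < T \<and> (f ^^ T) c \<in> D0"
    unfolding T_def by (rule LeastI[of _ "t - s"]) (use st \<open>(f ^^ (t - s)) c \<in> D0\<close> in simp)
  then have "0 < T" and TD0: "(f ^^ T) c \<in> D0" by auto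
  have before: "(f ^^ j) c \<notin> D0" if "0 < j" "j < T" for j
    using not_less_Least[of j "\<lambda>j. 0 < j \<and> (f ^^ j) c \<in> D0"] that by (auto simp: T_def)
  obtain D where "cell c D" and TD: "(f ^^ T) c \<in> D" and "closure D \<subseteq> D0"
    using D0cell TD0 by blast
  have "open D" "c \<in> D" using \<open>cell c D\<close> by (auto simp: cell_def)
  have DD0: "D \<subseteq> D0" using \<open>closure D \<subseteq> D0\<close> closure_subset by blast
  \<comment> \<open>\<open>p\<close> may enter \<open>D\<close> before it reaches \<open>c\<close>.
    From that moment on \<open>h\<close> interferes, so the first entrance itself has to be sent
    into the trap; hence the extra point in \<open>K\<close>.\<close>
  define i0 where "i0 = (LEAST j. 0 < j \<and> (f ^^ j) p \<in> D)"
  have "0 < i0 \<and> (f ^^ i0) p \<in> D"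
    unfolding i0_def by (rule LeastI[of _ s]) (use st \<open>c \<in> D\<close> in \<open>simp add: c_def\<close>)
  then have "0 < i0" and i0D: "(f ^^ i0) p \<in> D" by auto
  have before_i0: "(f ^^ j) p \<notin> D" if "0 < j" "j < i0" for j
    using not_less_Least[of j "\<lambda>j. 0 < j \<and> (f ^^ j) p \<in> D"] that by (auto simp: i0_def)
  obtain \<kappa> where "0 < \<kappa>" and \<kappa>: "cball ((f ^^ T) c) \<kappa> \<subseteq> D"
    using \<open>open D\<close> TD open_contains_cball by blast
  \<comment> \<open>The times \<open>j = 0\<close> and \<open>j = T\<close> are exempt from avoiding
    \<open>D\<close>: \<open>c\<close> lies in \<open>D\<close>, and at time \<open>T\<close> the
    map \<open>h\<close> is meant to act. The bound \<kappa> is used at time \<open>T\<close>, to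
    land in \<open>K\<close>; the bound \<open>\<epsilon> / 4\<close> is used before it, for the
    diameters.\<close>
  have near: "\<exists>\<rho>>0. \<forall>v. dist c v < \<rho> \<longrightarrow> (0 < j \<and> j < T \<longrightarrow> (f ^^ j) v \<notin> D) \<and>
      (f ^^ j) v \<in> ball ((f ^^ j) c) (min \<kappa> (\<epsilon> / 4))" for j
  proof -
    define O' where "O' = ball ((f ^^ j) c) (min \<kappa> (\<epsilon> / 4)) \<inter> (if 0 < j \<and> j < T then - closure D else UNIV)"
    have "open O'" by (auto simp: O'_def)
    have "(f ^^ j) c \<in> O'"
      using before[of j] \<open>closure D \<subseteq> D0\<close> \<open>0 < \<kappa>\<close> \<open>0 < \<epsilon>\<close> by (auto simp: O'_def)
    moreover have "open ((f ^^ j) -` O')"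
      using cont[of j] \<open>open O'\<close> by (simp add: open_vimage)
    ultimately obtain \<rho> where "0 < \<rho>" and \<rho>: "ball c \<rho> \<subseteq> (f ^^ j) -` O'"
      unfolding open_contains_ball by (metis vimageI)
    have "(f ^^ j) v \<in> O'" if "dist c v < \<rho>" for v
      using \<rho> that by (auto simp: subset_iff)
    then show ?thesis using \<open>0 < \<rho>\<close> closure_subset[of D]
      by (intro exI[of _ \<rho>]) (fastforce simp: O'_def)
  qed
  then obtain \<rho>' where \<rho>'0: "\<And>j. 0 < \<rho>' j" and \<rho>': "\<And>j v. dist c v < \<rho>' j \<Longrightarrow>
      (0 < j \<and> j < T \<longrightarrow> (f ^^ j) v \<notin> D) \<and> (f ^^ j) v \<in> ball ((f ^^ j) c) (min \<kappa> (\<epsilon> / 4))"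
    by metis
  define \<rho> where "\<rho> = Min (\<rho>' ` {..T})"
  have \<rho>: "0 < \<rho>" "\<And>j. j \<le> T \<Longrightarrow> \<rho> \<le> \<rho>' j"
    unfolding \<rho>_def using \<rho>'0 by (auto simp: Min_gr_iff)
  define K where "K = insert ((f ^^ i0) p) (cball ((f ^^ T) c) \<kappa>)"
  have "compact (cball ((f ^^ T) c) \<kappa>)"
    using compact_Int_closed[OF cpt closed_cball] by simp
  then have "compact K" by (simp add: K_def)
  moreover have "K \<subseteq> D" using \<kappa> i0D by (simp add: K_def)
  ultimately obtain h k where hk: "homeomorphism UNIV UNIV h k"
    and h: "\<And>y. y \<notin> D \<Longrightarrow> h y = y" and hK: "h ` K \<subseteq> ball c (\<rho> / 2)"
    using cellE[OF \<open>cell c D\<close>, of K "ball c (\<rho> / 2)"] \<open>0 < \<rho>\<close>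
    by (metis centre_in_ball half_gt_zero open_ball)
  define g where "g = h \<circ> f"
  have "g \<in> Homeo"
    using homeomorphism_compose[OF f' hk] by (auto simp: Homeo_def g_def)
  moreover have "C0_dist f g < r"
  proof -
    have "dist x (h x) \<le> \<eta>" for x
    proof (cases "x \<in> D")
      case True
      then have "h x \<in> D" using homeomorphism_support[OF hk, of D] h by blast
      then show ?thesis using D0 DD0 True by (auto intro: less_imp_le)
    qed (use h \<open>0 < \<eta>\<close> in simp)
    then have "C0_dist f g \<le> \<eta>" by (intro C0_dist_le) (simp add: g_def)
    then show ?thesis using \<open>0 < r\<close> by (simp add: \<eta>_def)
  qed
  moreover have "trapped \<epsilon> g p"
  proof (rule trappedI[where V = "ball c \<rho>" and n = i0 and T = T and \<eta> = "min (\<rho> / 2) (\<epsilon> / 4)"])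
    have gS: "(g ^^ Suc j) x = h (f ((g ^^ j) x))" for j x
      by (simp add: g_def)
    \<comment> \<open>\<open>h\<close> acts after \<open>f\<close>, so only positive times matter:
      the orbit may start inside \<open>D\<close>.\<close>
    have pow: "(g ^^ j) x = (f ^^ j) x" if "\<And>i. 0 < i \<Longrightarrow> i \<le> j \<Longrightarrow> (f ^^ i) x \<notin> D" for j x
      using that
    proof (induction j)
      case (Suc j)
      have "(g ^^ j) x = (f ^^ j) x" using Suc by auto
      moreover have "h ((f ^^ Suc j) x) = (f ^^ Suc j) x" using h Suc.prems by blast
      ultimately show ?case unfolding gS by simp
    qed simp
    have powS: "(g ^^ n) x = h ((f ^^ n) x)"
      if "0 < n" "\<And>i. 0 < i \<Longrightarrow> i < n \<Longrightarrow> (f ^^ i) x \<notin> D" for n x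
    proof -
      obtain n' where "n = Suc n'" using \<open>0 < n\<close> by (cases n) auto
      then have "(g ^^ n) x = h (f ((g ^^ n') x))" by (simp only: gS)
      then show ?thesis using pow[of n' x] that(2) \<open>n = Suc n'\<close> by simp
    qed
    have sub: "ball y (min (\<rho> / 2) (\<epsilon> / 4)) \<subseteq> ball c \<rho>" if "y \<in> ball c (\<rho> / 2)" for y
      using that dist_triangle_half_r[of y c \<rho>] dist_triangle_less_add[of c y "\<rho> / 2" _ "\<rho> / 2"]
      by (auto simp: dist_commute)
    have V: "(0 < j \<and> j < T \<longrightarrow> (f ^^ j) v \<notin> D) \<and> (f ^^ j) v \<in> ball ((f ^^ j) c) (min \<kappa> (\<epsilon> / 4))"
      if "v \<in> ball c \<rho>" "j \<le> T" for v j
      using \<rho>'[of v j] \<rho>(2)[OF that(2)] that(1) by simp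
    have "(g ^^ i0) p = h ((f ^^ i0) p)" using powS \<open>0 < i0\<close> before_i0 by blast
    then show "ball ((g ^^ i0) p) (min (\<rho> / 2) (\<epsilon> / 4)) \<subseteq> ball c \<rho>"
      using hK by (intro sub) (auto simp: K_def)
    show "ball ((g ^^ T) v) (min (\<rho> / 2) (\<epsilon> / 4)) \<subseteq> ball c \<rho>" if "v \<in> ball c \<rho>" for v
    proof (rule sub)
      have "(g ^^ T) v = h ((f ^^ T) v)"
        using powS[OF \<open>0 < T\<close>, of v] V[OF that] by simp
      moreover have "(f ^^ T) v \<in> K"
        using V[OF that, of T] by (auto simp: K_def)
      ultimately show "(g ^^ T) v \<in> ball c (\<rho> / 2)" using hK by auto
    qed
    show "dist ((g ^^ j) v) ((g ^^ j) w) + min (\<rho> / 2) (\<epsilon> / 4) \<le> \<epsilon>"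
      if "j < T" and v: "v \<in> ball c \<rho>" and w: "w \<in> ball c \<rho>" for j v w
    proof -
      have "(g ^^ j) v = (f ^^ j) v" "(g ^^ j) w = (f ^^ j) w"
        using pow[of j v] pow[of j w] V[OF v] V[OF w] \<open>j < T\<close> by auto
      moreover have "dist ((f ^^ j) c) ((f ^^ j) v) < \<epsilon> / 4" "dist ((f ^^ j) c) ((f ^^ j) w) < \<epsilon> / 4"
        using V[OF v, of j] V[OF w, of j] \<open>j < T\<close> by auto
      moreover have "min (\<rho> / 2) (\<epsilon> / 4) \<le> \<epsilon> / 4" by simp
      ultimately show ?thesis
        using dist_triangle3[of "(f ^^ j) v" "(f ^^ j) w" "(f ^^ j) c"] \<open>0 < \<epsilon>\<close> by simp
    qed
  qed (use \<open>0 < \<rho>\<close> \<open>0 < \<epsilon>\<close> \<open>0 < T\<close> in auto)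
  ultimately show ?thesis by blast
qed

lemma Homeo_continuous: "f \<in> Homeo \<Longrightarrow> continuous_on UNIV f"
  by (auto simp: Homeo_def homeomorphism_def)

text \<open>Points that are already trapped survive a small enough perturbation, so each new point
  is treated within a budget \<open>t\<close> that respects both them and what is left of
  \<open>r\<close>.\<close>

lemma trapped_finite_dense:
  fixes f :: "'a::metric_space \<Rightarrow> 'a"
  assumes cpt: "compact (UNIV :: 'a set)" and cells: "small_cells_everywhere TYPE('a)"
    and f: "f \<in> Homeo" and "0 < \<epsilon>" and "0 < r" and "finite P"
  shows "\<exists>g\<in>Homeo. C0_dist f g < r \<and> (\<forall>p\<in>P. trapped \<epsilon> g p)"
  using \<open>finite P\<close>
proof (induction P rule: finite_induct)
  case empty
  then show ?case using f \<open>0 < r\<close> by (intro bexI[of _ f]) auto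
next
  case (insert p P)
  then obtain g where g: "g \<in> Homeo" "C0_dist f g < r" "\<And>q. q \<in> P \<Longrightarrow> trapped \<epsilon> g q"
    by blast
  have "\<forall>q\<in>P. \<exists>s>0. \<forall>g'. C0_dist g g' < s \<longrightarrow> trapped \<epsilon> g' q"
    using trapped_open[OF cpt Homeo_continuous[OF g(1)] g(3)] by (metis dist_self)
  then obtain s where s: "\<And>q. q \<in> P \<Longrightarrow> 0 < s q"
    "\<And>q g'. q \<in> P \<Longrightarrow> C0_dist g g' < s q \<Longrightarrow> trapped \<epsilon> g' q"
    by metis
  define t where "t = Min (insert (r - C0_dist f g) (s ` P))"
  have t: "0 < t" "t \<le> r - C0_dist f g" "\<And>q. q \<in> P \<Longrightarrow> t \<le> s q"
    unfolding t_def using g(2) s(1) insert.hyps(1) by (auto simp: Min_gr_iff)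
  obtain g' where g': "g' \<in> Homeo" "C0_dist g g' < t" "trapped \<epsilon> g' p"
    using trapped_dense[OF cpt cells g(1) \<open>0 < \<epsilon>\<close> t(1)] by blast
  show ?case
  proof (intro bexI[of _ g'] conjI ballI)
    show "C0_dist f g' < r"
      using Metric_space.triangle[OF Metric_space_Homeo[OF cpt] f g(1) g'(1)] g'(2) t(2) by linarith
    show "trapped \<epsilon> g' q" if "q \<in> insert p P" for q
      using that g' s(2)[of q g'] t(3)[of q] by auto
  qed (rule g'(1))
qed

text \<open>Homeomorphisms supported in disjoint cells do not interfere, so their composition acts
  on each cell as the one belonging to it. Preservation of every cell is recorded because it bounds
  the displacement by the diameters.\<close>

lemma squeeze_into_open:
  fixes E :: "'a::metric_space set"
  assumes "finite \<D>" and "disjoint \<D>" and "\<And>D. D \<in> \<D> \<Longrightarrow> cell (c D) D"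
    and "\<And>D. D \<in> \<D> \<Longrightarrow> compact (K D) \<and> K D \<subseteq> D \<and> c D \<in> E" and "open E"
  shows "\<exists>h k. homeomorphism UNIV UNIV h k \<and> (\<forall>x. x \<notin> \<Union>\<D> \<longrightarrow> h x = x) \<and>
    (\<forall>D\<in>\<D>. h ` D \<subseteq> D \<and> h ` K D \<subseteq> E)"
  using assms
proof (induction \<D> rule: finite_induct)
  case empty
  then show ?case using homeomorphism_ident[of UNIV] by (intro exI[of _ "\<lambda>x. x"]) simp
next
  case (insert D \<D>)
  have dis: "D \<inter> D' = {}" if "D' \<in> \<D>" for D'
    using insert.prems(1) insert.hyps(2) that by (auto simp: pairwise_insert disjnt_def)
  have "disjoint \<D>" using insert.prems(1) by (simp add: pairwise_insert)
  with insert obtain h k where hk: "homeomorphism UNIV UNIV h k"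
    and h: "\<And>x. x \<notin> \<Union>\<D> \<Longrightarrow> h x = x" "\<And>D. D \<in> \<D> \<Longrightarrow> h ` D \<subseteq> D" "\<And>D. D \<in> \<D> \<Longrightarrow> h ` K D \<subseteq> E"
    by (metis insertCI)
  obtain h' k' where hk': "homeomorphism UNIV UNIV h' k'"
    and h': "\<And>y. y \<notin> D \<Longrightarrow> h' y = y" "h' ` K D \<subseteq> E"
    using cellE[of "c D" D "K D" E] insert.prems by (metis insertI1)
  have hD: "h x = x" if "x \<in> D" for x
    using h(1)[of x] dis that by blast
  have off: "h' (h x) = h x" if "x \<in> D'" "D' \<in> \<D>" for x D'
    using h'(1)[of "h x"] h(2)[OF that(2)] dis[OF that(2)] that(1) by blast
  show ?case
  proof (rule exI[of _ "h' \<circ> h"], rule exI[of _ "k \<circ> k'"], intro conjI ballI allI impI)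
    show "homeomorphism UNIV UNIV (h' \<circ> h) (k \<circ> k')"
      by (rule homeomorphism_compose[OF hk hk'])
    show "(h' \<circ> h) x = x" if "x \<notin> \<Union>(insert D \<D>)" for x
      using that h(1) h'(1) by auto
    fix D' assume D': "D' \<in> insert D \<D>"
    show "(h' \<circ> h) ` D' \<subseteq> D'"
    proof (cases "D' = D")
      case True
      then show ?thesis using hD homeomorphism_support[OF hk' h'(1)] by auto
    next
      case False
      then show ?thesis using D' off h(2)[of D'] by auto
    qed
    show "(h' \<circ> h) ` K D' \<subseteq> E"
    proof (cases "D' = D")
      case True
      have "h ` K D = K D" using hD insert.prems(3)[of D] by force
      then show ?thesis unfolding image_comp[symmetric] True using h'(2) by simp
    next
      case False
      then have "K D' \<subseteq> D'" "D' \<in> \<D>" using D' insert.prems(3)[of D'] by auto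
      then show ?thesis using off[of _ D'] h(3)[of D'] by (auto simp: subset_iff)
    qed
  qed
qed

section \<open>Chart balls are cells\<close>

definition chart :: "'a::metric_space set \<Rightarrow> ('a \<Rightarrow> 'e::euclidean_space) \<Rightarrow> ('e \<Rightarrow> 'a) \<Rightarrow> bool" where
  "chart U \<phi> \<psi> \<longleftrightarrow> open U \<and> open (\<phi> ` U) \<and> homeomorphism U (\<phi> ` U) \<phi> \<psi>"

lemma chart_inverse:
  assumes "chart U \<phi> \<psi>"
  shows "x \<in> U \<Longrightarrow> \<psi> (\<phi> x) = x" and "y \<in> \<phi> ` U \<Longrightarrow> \<phi> (\<psi> y) = y"
  using assms unfolding chart_def homeomorphism_def by auto

lemma chart_image_iff:
  assumes "chart U \<phi> \<psi>" "B \<subseteq> \<phi> ` U"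
  shows "z \<in> \<psi> ` B \<longleftrightarrow> z \<in> U \<and> \<phi> z \<in> B"
proof
  show "z \<in> U \<and> \<phi> z \<in> B" if "z \<in> \<psi> ` B"
    using that assms(2) chart_inverse[OF assms(1)] by force
  show "z \<in> \<psi> ` B" if "z \<in> U \<and> \<phi> z \<in> B"
    using that chart_inverse(1)[OF assms(1), of z] by (metis imageI)
qed

lemma chart_continuous:
  assumes "chart U \<phi> \<psi>"
  shows "continuous_on U \<phi>" "continuous_on (\<phi> ` U) \<psi>"
  using assms unfolding chart_def homeomorphism_def by auto

lemma chart_open_image:
  assumes "chart U \<phi> \<psi>" "open B" "B \<subseteq> \<phi> ` U"
  shows "open (\<psi> ` B)"
proof -
  have "homeomorphism (\<phi> ` U) U \<psi> \<phi>"
    using assms(1) homeomorphism_sym[of U "\<phi> ` U"] by (simp add: chart_def)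
  then have "openin (top_of_set U) (\<psi> ` B)"
    using homeomorphism_imp_open_map open_subset[OF assms(3,2)] by blast
  then show ?thesis
    using assms(1) by (auto simp: chart_def openin_open_eq)
qed

lemma chart_compact_image:
  assumes "chart U \<phi> \<psi>" "compact B" "B \<subseteq> \<phi> ` U"
  shows "compact (\<psi> ` B)"
  using compact_continuous_image[OF continuous_on_subset[OF chart_continuous(2)[OF assms(1)] assms(3)] assms(2)] .

text \<open>The radial power map: it keeps directions and replaces the relative radius
  \<open>norm x / r\<close> by its power with exponent \<open>a\<close>. It fixes the sphere of
  radius \<open>r\<close>, and its inverse has exponent \<open>1 / a\<close>.\<close>

definition squash :: "real \<Rightarrow> real \<Rightarrow> 'e::euclidean_space \<Rightarrow> 'e" where
  "squash r a x = ((norm x / r) powr (a - 1)) *\<^sub>R x"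

lemma norm_squash:
  assumes "0 < r" "0 < a"
  shows "norm (squash r a x) = r * (norm x / r) powr a"
proof (cases "x = 0")
  case False
  then have "(norm x / r) powr a = (norm x / r) powr (a - 1) * (norm x / r)"
    using powr_mult_base[of "norm x / r" "a - 1"] assms by (simp add: mult.commute)
  then show ?thesis using assms(1) by (simp add: squash_def)
qed (simp add: squash_def)

lemma squash_inverse:
  assumes "0 < r" "0 < a"
  shows "squash r (1 / a) (squash r a x) = x"
proof (cases "x = 0")
  case False
  have "squash r (1 / a) (squash r a x) =
      (((norm x / r) powr a) powr (1 / a - 1) * (norm x / r) powr (a - 1)) *\<^sub>R x"
    using assms by (simp add: squash_def[of r "1 / a"] norm_squash) (simp add: squash_def)
  also have "((norm x / r) powr a) powr (1 / a - 1) * (norm x / r) powr (a - 1) =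
      (norm x / r) powr (a * (1 / a - 1) + (a - 1))"
    by (simp add: powr_powr powr_add)
  also have "a * (1 / a - 1) + (a - 1) = 0"
    using assms by (simp add: field_simps)
  finally show ?thesis using False assms by simp
qed (simp add: squash_def)

lemma squash_sphere: "0 < r \<Longrightarrow> norm x = r \<Longrightarrow> squash r a x = x"
  by (simp add: squash_def)

lemma norm_squash_less:
  assumes "0 < r" "0 < a" "norm x < r"
  shows "norm (squash r a x) < r"
proof -
  have "(norm x / r) powr a < 1 powr a"
    using assms by (intro powr_less_mono2) auto
  then show ?thesis using assms by (simp add: norm_squash)
qed

text \<open>For \<open>1 < a\<close> the scaling factor has a positive exponent and is continuous at
  0. The factor of the inverse blows up there, which is why continuity of the inverse is later taken
  from compactness.\<close>

lemma continuous_squash: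
  assumes "0 < r" "1 < a"
  shows "continuous_on S (squash r a)"
  unfolding squash_def
  by (use assms in \<open>auto intro!: continuous_intros continuous_on_powr'\<close>)

lemma squash_arbitrarily:
  assumes "0 < r" "0 < t" "s < r"
  shows "\<exists>a>1. \<forall>x::'e::euclidean_space. norm x \<le> s \<longrightarrow> norm (squash r a x) < t"
proof -
  \<comment> \<open>\<open>s\<close> is only known to be below \<open>r\<close> and may be negative,
    hence the maximum.\<close>
  define q where "q = max s 0 / r"
  have q: "0 \<le> q" "q < 1" using assms by (auto simp: q_def)
  obtain n where n: "q ^ n < t / r"
    using real_arch_pow_inv[of "t / r" q] q assms by auto
  show ?thesis
  \<comment> \<open>Adding 2 makes the exponent exceed 1, and makes it nonzero so that
    \<open>powr\<close> agrees with the ordinary power even at base 0.\<close>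
  proof (intro exI[of _ "real (n + 2)"] conjI allI impI)
    fix x :: 'e assume "norm x \<le> s"
    then have "norm x / r \<le> q" using assms(1) by (simp add: q_def divide_right_mono)
    then have "(norm x / r) powr real (n + 2) \<le> q powr real (n + 2)"
      using assms(1) by (intro powr_mono2) auto
    also have "\<dots> = q ^ (n + 2)"
      using q(1) by (intro powr_realpow') auto
    also have "\<dots> \<le> q ^ n" using q by (intro power_decreasing) auto
    finally have "(norm x / r) powr real (n + 2) < t / r" using n by linarith
    then show "norm (squash r (real (n + 2)) x) < t"
      using assms(1) by (simp add: norm_squash field_simps del: of_nat_add)
  qed simp
qed

text \<open>The radial power map is transported by the chart and extended by the identity; it fixes
  the bounding sphere, so the two pieces fit together.\<close>

lemma cell_chart_ball:
  fixes \<phi> :: "'a::metric_space \<Rightarrow> 'e::euclidean_space"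
  assumes cpt: "compact (UNIV :: 'a set)" and ch: "chart U \<phi> \<psi>"
    and "0 < r" and yr: "cball y r \<subseteq> \<phi> ` U"
  shows "cell (\<psi> y) (\<psi> ` ball y r)"
proof -
  define D where "D = \<psi> ` ball y r"
  have b: "ball y r \<subseteq> \<phi> ` U" using yr ball_subset_cball by blast
  have D_iff: "z \<in> D \<longleftrightarrow> z \<in> U \<and> \<phi> z \<in> ball y r" for z
    unfolding D_def by (rule chart_image_iff[OF ch b])
  have "open D" unfolding D_def using b by (intro chart_open_image[OF ch]) auto
  have "\<psi> y \<in> D" using \<open>0 < r\<close> by (simp add: D_def)
  define C where "C = \<psi> ` cball y r"
  have C_iff: "z \<in> C \<longleftrightarrow> z \<in> U \<and> \<phi> z \<in> cball y r" for z
    unfolding C_def by (rule chart_image_iff[OF ch yr])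
  have "closed C" unfolding C_def
    using yr by (intro compact_imp_closed chart_compact_image[OF ch]) auto
  define H where "H a z = \<psi> (y + squash r a (\<phi> z - y))" for a z
  have sq: "y + squash r a (x - y) \<in> ball y r" if "0 < a" "x \<in> ball y r" for a x
    using norm_squash_less[OF \<open>0 < r\<close> \<open>0 < a\<close>, of "x - y"] that(2)
    by (simp add: dist_norm norm_minus_commute)
  have HD: "H a z \<in> D" and HH: "H (1 / a) (H a z) = z" if "0 < a" "z \<in> D" for a z
  proof -
    have *: "y + squash r a (\<phi> z - y) \<in> ball y r" using sq that by (simp add: D_iff)
    then show "H a z \<in> D" by (auto simp: H_def D_def)
    have "\<phi> (H a z) = y + squash r a (\<phi> z - y)"
      unfolding H_def using * b by (intro chart_inverse(2)[OF ch]) blast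
    then have "H (1 / a) (H a z) = \<psi> (\<phi> z)"
      unfolding H_def[of "1 / a"] by (simp add: squash_inverse[OF \<open>0 < r\<close> \<open>0 < a\<close>])
    then show "H (1 / a) (H a z) = z"
      using that(2) chart_inverse(1)[OF ch] by (simp add: D_iff)
  qed
  define h where "h a z = (if z \<in> D then H a z else z)" for a z
  have hh: "h (1 / a) (h a z) = z" if "0 < a" for a z
    using HD[OF that] HH[OF that] by (simp add: h_def)
  \<comment> \<open>Gluing along the closed sets \<open>C\<close> and \<open>- D\<close>, which meet
    in the preimage of the sphere. \<open>C\<close> is closed in the whole space because it is
    compact.\<close>
  have conth: "continuous_on UNIV (h a)" if "1 < a" for a
  proof -
    have "continuous_on (C \<union> - D) (h a)"
      unfolding h_def
    proof (rule continuous_on_cases)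
      have "continuous_on C \<phi>"
        by (rule continuous_on_subset[OF chart_continuous(1)[OF ch]]) (auto simp: C_iff)
      then have 1: "continuous_on C (\<lambda>z. y + squash r a (\<phi> z - y))"
        by (intro continuous_intros continuous_on_compose2[OF continuous_squash[OF \<open>0 < r\<close> that, of UNIV]]) auto
      have 2: "y + squash r a (\<phi> z - y) \<in> \<phi> ` U" if z: "z \<in> C" for z
      proof (cases "z \<in> D")
        case True
        then show ?thesis using sq[of a "\<phi> z"] \<open>1 < a\<close> b by (auto simp: D_iff)
      next
        case False
        then have "norm (\<phi> z - y) = r" using z by (auto simp: C_iff D_iff dist_norm norm_minus_commute)
        then show ?thesis using squash_sphere[OF \<open>0 < r\<close>, of "\<phi> z - y" a] z by (simp add: C_iff)
      qed
      show "continuous_on C (H a)"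
        unfolding H_def
        by (rule continuous_on_compose2[OF chart_continuous(2)[OF ch] 1]) (use 2 in auto)
      show "\<forall>z. z \<in> C \<and> z \<notin> D \<or> z \<in> - D \<and> z \<in> D \<longrightarrow> H a z = z"
      proof (intro allI impI)
        fix z assume "z \<in> C \<and> z \<notin> D \<or> z \<in> - D \<and> z \<in> D"
        then have z: "z \<in> U" "norm (\<phi> z - y) = r"
          by (auto simp: C_iff D_iff dist_norm norm_minus_commute)
        then show "H a z = z"
          using squash_sphere[OF \<open>0 < r\<close> z(2)] chart_inverse(1)[OF ch] by (simp add: H_def)
      qed
    qed (use \<open>closed C\<close> \<open>open D\<close> in \<open>auto simp: continuous_on_id\<close>)
    moreover have "C \<union> - D = UNIV" by (auto simp: C_iff D_iff)
    ultimately show ?thesis by simp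
  qed
  have "\<exists>h k. homeomorphism UNIV UNIV h k \<and> (\<forall>z. z \<notin> D \<longrightarrow> h z = z) \<and> h ` K \<subseteq> V"
    if K: "compact K" "K \<subseteq> D" and V: "open V" "\<psi> y \<in> V" for K V
  proof -
    have KU: "K \<subseteq> U" using K(2) by (auto simp: D_iff)
    have "compact (\<phi> ` K)"
      by (rule compact_continuous_image[OF continuous_on_subset[OF chart_continuous(1)[OF ch] KU] K(1)])
    then have cptS: "compact ((\<lambda>x. norm (x - y)) ` \<phi> ` K)"
      by (rule compact_continuous_image[rotated]) (intro continuous_intros)
    have lt: "\<forall>v\<in>(\<lambda>x. norm (x - y)) ` \<phi> ` K. v < r"
      using K(2) by (auto simp: D_iff dist_norm norm_minus_commute)
    \<comment> \<open>A compact subset of the open ball keeps a positive distance from the sphere;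
      this is what a large exponent needs.\<close>
    have "\<exists>s<r. \<forall>v\<in>(\<lambda>x. norm (x - y)) ` \<phi> ` K. v \<le> s"
    proof (cases "K = {}")
      case False
      then show ?thesis using compact_attains_sup[OF cptS] lt by (metis image_is_empty)
    qed (use \<open>0 < r\<close> in auto)
    then obtain s where s: "s < r" "\<And>z. z \<in> K \<Longrightarrow> norm (\<phi> z - y) \<le> s"
      by auto
    have "open (\<phi> ` U \<inter> \<psi> -` V)"
      using chart_continuous(2)[OF ch] V(1) ch
      by (auto simp: chart_def intro: continuous_open_preimage)
    moreover have "y \<in> \<phi> ` U \<inter> \<psi> -` V"
      using V(2) b \<open>0 < r\<close> by auto
    ultimately obtain t where "0 < t" and t: "ball y t \<subseteq> \<phi> ` U \<inter> \<psi> -` V"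
      using open_contains_ball by blast
    obtain a where "1 < a" and a: "\<And>x::'e. norm x \<le> s \<Longrightarrow> norm (squash r a x) < t"
      using squash_arbitrarily[OF \<open>0 < r\<close> \<open>0 < t\<close> s(1)] by blast
    \<comment> \<open>The algebraic inverse yields bijectivity; a continuous bijection of a compact
      Hausdorff space is a homeomorphism.\<close>
    have "h a (h (1 / a) z) = z" for z
      using hh[of "1 / a" z] \<open>1 < a\<close> by simp
    then have "range (h a) = UNIV" by (rule surjI)
    moreover have "inj (h a)"
      using hh[of a] \<open>1 < a\<close> by (intro inj_on_inverseI[of _ "h (1 / a)"]) simp
    ultimately obtain k where "homeomorphism UNIV UNIV (h a) k"
      using homeomorphism_compact[OF cpt conth[OF \<open>1 < a\<close>]] by blast
    have "h a z \<in> V" if "z \<in> K" for z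
    proof -
      have "y + squash r a (\<phi> z - y) \<in> ball y t"
        using a[OF s(2)[OF that]] by (simp add: dist_norm)
      then show ?thesis using t that K(2) by (auto simp: h_def H_def)
    qed
    then have "h a ` K \<subseteq> V" by blast
    moreover note \<open>homeomorphism UNIV UNIV (h a) k\<close>
    moreover have "\<forall>z. z \<notin> D \<longrightarrow> h a z = z" by (simp add: h_def)
    ultimately show ?thesis by blast
  qed
  then show ?thesis
    using \<open>open D\<close> \<open>\<psi> y \<in> D\<close> unfolding cell_def D_def[symmetric] by simp
qed

text \<open>All sets are balls in one chart. Points of \<open>N\<close> have coordinates within
  \<open>\<rho> / 4\<close> of those of \<open>z\<close>, so the ball of radius
  \<open>\<rho> / 2\<close> about \<open>c\<close> contains \<open>b\<close> and stays inside the
  ball of radius \<rho>. The cells are concentric with it.\<close>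

lemma small_cells_everywhere_charts:
  assumes cpt: "compact (UNIV :: 'a::metric_space set)"
    and charts: "\<And>z::'a. \<exists>U (\<phi>::'a \<Rightarrow> 'e::euclidean_space) \<psi>. chart U \<phi> \<psi> \<and> z \<in> U"
  shows "small_cells_everywhere TYPE('a)"
  unfolding small_cells_everywhere_def
proof (intro allI impI)
  fix z :: 'a and \<eta> :: real assume "0 < \<eta>"
  obtain U \<psi> and \<phi> :: "'a \<Rightarrow> 'e" where ch: "chart U \<phi> \<psi>" and "z \<in> U"
    using charts[of z] by blast
  have "open (\<phi> ` U \<inter> \<psi> -` ball z (\<eta> / 2))"
    using chart_continuous(2)[OF ch] ch by (auto simp: chart_def intro: continuous_open_preimage)
  moreover have "\<phi> z \<in> \<phi> ` U \<inter> \<psi> -` ball z (\<eta> / 2)"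
    using \<open>z \<in> U\<close> \<open>0 < \<eta>\<close> chart_inverse(1)[OF ch] by simp
  ultimately obtain \<rho> where "0 < \<rho>" and \<rho>: "ball (\<phi> z) \<rho> \<subseteq> \<phi> ` U \<inter> \<psi> -` ball z (\<eta> / 2)"
    using open_contains_ball by blast
  define N where "N = \<psi> ` ball (\<phi> z) (\<rho> / 4)"
  have sub: "ball (\<phi> z) (\<rho> / 4) \<subseteq> \<phi> ` U"
    using \<rho> \<open>0 < \<rho>\<close> subset_ball[of "\<rho> / 4" \<rho> "\<phi> z"] by auto
  have N_iff: "x \<in> N \<longleftrightarrow> x \<in> U \<and> \<phi> x \<in> ball (\<phi> z) (\<rho> / 4)" for x
    unfolding N_def by (rule chart_image_iff[OF ch sub])
  have "joined_by_cells \<eta> c b" if c: "c \<in> N" and b: "b \<in> N" for c b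
  proof -
    define D0 where "D0 = \<psi> ` ball (\<phi> c) (\<rho> / 2)"
    have c': "c \<in> U" "dist (\<phi> z) (\<phi> c) < \<rho> / 4" using c by (auto simp: N_iff)
    have cb: "dist (\<phi> c) (\<phi> b) < \<rho> / 2"
      using c b dist_triangle_less_add[of "\<phi> c" "\<phi> z" "\<rho> / 4" "\<phi> b" "\<rho> / 4"]
      by (auto simp: N_iff dist_commute)
    have sub0: "ball (\<phi> c) (\<rho> / 2) \<subseteq> ball (\<phi> z) \<rho>"
    proof
      fix x assume "x \<in> ball (\<phi> c) (\<rho> / 2)"
      then show "x \<in> ball (\<phi> z) \<rho>"
        using c'(2) dist_triangle[of "\<phi> z" x "\<phi> c"] \<open>0 < \<rho>\<close> by simp
    qed
    have subU: "ball (\<phi> c) (\<rho> / 2) \<subseteq> \<phi> ` U" using sub0 \<rho> by blast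
    have D0_iff: "x \<in> D0 \<longleftrightarrow> x \<in> U \<and> \<phi> x \<in> ball (\<phi> c) (\<rho> / 2)" for x
      unfolding D0_def by (rule chart_image_iff[OF ch subU])
    have small: "dist z x < \<eta> / 2" if "x \<in> D0" for x
    proof -
      have "\<phi> x \<in> \<psi> -` ball z (\<eta> / 2)" using that sub0 \<rho> unfolding D0_iff by blast
      then show ?thesis using that chart_inverse(1)[OF ch] by (simp add: D0_iff)
    qed
    show ?thesis
      unfolding joined_by_cells_def
    proof (rule exI[of _ D0], intro conjI ballI)
      show "open D0" unfolding D0_def using subU by (intro chart_open_image[OF ch]) auto
      show "c \<in> D0" using c' \<open>0 < \<rho>\<close> by (simp add: D0_iff)
      show "b \<in> D0" using b cb by (simp add: D0_iff N_iff)
      show "dist x y < \<eta>" if "x \<in> D0" "y \<in> D0" for x y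
        using small[OF that(1)] small[OF that(2)] dist_triangle3[of x y z] by linarith
      fix x assume x: "x \<in> D0"
      \<comment> \<open>Halfway between the point and the boundary of \<open>D0\<close>, so that the
        open ball contains \<open>x\<close> and the closed one stays in \<open>D0\<close>.\<close>
      define r where "r = (dist (\<phi> c) (\<phi> x) + \<rho> / 2) / 2"
      have r: "dist (\<phi> c) (\<phi> x) < r" "r < \<rho> / 2" "0 < r"
        using x \<open>0 < \<rho>\<close> by (auto simp: D0_iff r_def intro: add_nonneg_pos)
      then have cb: "cball (\<phi> c) r \<subseteq> ball (\<phi> c) (\<rho> / 2)" by auto
      then have cbU: "cball (\<phi> c) r \<subseteq> \<phi> ` U" using subU by blast
      show "\<exists>D. cell c D \<and> x \<in> D \<and> closure D \<subseteq> D0"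
      proof (intro exI[of _ "\<psi> ` ball (\<phi> c) r"] conjI)
        show "cell c (\<psi> ` ball (\<phi> c) r)"
          using cell_chart_ball[OF cpt ch r(3) cbU] chart_inverse(1)[OF ch c'(1)] by simp
        have "ball (\<phi> c) r \<subseteq> \<phi> ` U" using cbU ball_subset_cball by blast
        then show "x \<in> \<psi> ` ball (\<phi> c) r"
          using x r(1) by (simp add: chart_image_iff[OF ch] D0_iff)
        have "closed (\<psi> ` cball (\<phi> c) r)"
          using cbU by (intro compact_imp_closed chart_compact_image[OF ch]) auto
        then have "closure (\<psi> ` ball (\<phi> c) r) \<subseteq> \<psi> ` cball (\<phi> c) r"
          by (intro closure_minimal image_mono ball_subset_cball)
        also have "\<dots> \<subseteq> D0" unfolding D0_def using cb by (rule image_mono)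
        finally show "closure (\<psi> ` ball (\<phi> c) r) \<subseteq> D0" .
      qed
    qed
  qed
  moreover have "open N" unfolding N_def using sub by (intro chart_open_image[OF ch]) auto
  moreover have "z \<in> N" using \<open>z \<in> U\<close> \<open>0 < \<rho>\<close> by (simp add: N_iff)
  ultimately show "\<exists>N. open N \<and> z \<in> N \<and> (\<forall>c\<in>N. \<forall>b\<in>N. joined_by_cells \<eta> c b)" by blast
qed

section \<open>Covering almost all of the space by small cells\<close>

text \<open>Absolute continuity of \<open>m\<close> with respect to Lebesgue measure in coordinates.
  It is applied to the remainder of a Vitali covering and to boundary spheres.\<close>

definition chart_null :: "'a::metric_space measure \<Rightarrow> 'a set \<Rightarrow> ('a \<Rightarrow> 'e::euclidean_space) \<Rightarrow> bool" where
  "chart_null m U \<phi> \<longleftrightarrow> (\<forall>B\<in>sets borel. B \<subseteq> U \<longrightarrow> negligible (\<phi> ` B) \<longrightarrow> measure m B = 0)"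

text \<open>The null boundary makes it free of charge to remove the closures of cells already
  chosen, so that what remains for the next chart is open.\<close>

definition thin_cell :: "'a::metric_space measure \<Rightarrow> real \<Rightarrow> 'a set \<Rightarrow> bool" where
  "thin_cell m \<delta> D \<longleftrightarrow> (\<exists>c. cell c D) \<and> (\<forall>x\<in>D. \<forall>y\<in>D. dist x y < \<delta>) \<and> measure m (closure D - D) = 0"

text \<open>The coordinate balls with small preimage and with closed ball inside the image of
  \<open>G\<close> form a fine cover. Vitali's theorem extracts a countable disjoint family that
  misses only a null set, and continuity of the measure from above leaves finitely many of
  them.\<close>

lemma thin_cells_cover_chart:
  fixes m :: "'a::metric_space measure" and \<phi> :: "'a \<Rightarrow> 'e::euclidean_space"
  assumes cpt: "compact (UNIV :: 'a set)" and ch: "chart U \<phi> \<psi>"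
    and fin: "finite_measure m" and borel: "sets m = sets borel" and null: "chart_null m U \<phi>"
    and G: "open G" "G \<subseteq> U" and "0 < \<delta>" and "0 < \<epsilon>"
  shows "\<exists>\<D>. finite \<D> \<and> disjoint \<D> \<and> (\<forall>D\<in>\<D>. thin_cell m \<delta> D \<and> closure D \<subseteq> G) \<and>
    measure m (G - \<Union>\<D>) < \<epsilon>"
proof -
  interpret finite_measure m by (rule fin)
  have nul: "measure m B = 0" if "B \<in> sets borel" "B \<subseteq> U" "negligible (\<phi> ` B)" for B
    using null that by (simp add: chart_null_def)
  define F where "F i = \<psi> ` ball (fst i) (snd i)" for i :: "'e \<times> real"
  define I where "I = {i. 0 < snd i \<and> cball (fst i) (snd i) \<subseteq> \<phi> ` G \<and> (\<forall>x\<in>F i. \<forall>y\<in>F i. dist x y < \<delta>)}"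
  have GU: "\<phi> ` G \<subseteq> \<phi> ` U" using G(2) by blast
  have "openin (top_of_set (\<phi> ` U)) (\<phi> ` G)"
    using ch open_subset[OF G(2,1)] homeomorphism_imp_open_map unfolding chart_def by blast
  then have "open (\<phi> ` G)" using ch by (auto simp: chart_def openin_open_eq)
  have fine: "\<exists>i. i \<in> I \<and> x \<in> ball (fst i) (snd i) \<and> snd i < d" if x: "x \<in> \<phi> ` G" and "0 < d" for x d
  proof -
    have "open (\<phi> ` G \<inter> \<psi> -` ball (\<psi> x) (\<delta> / 2))"
      using continuous_on_subset[OF chart_continuous(2)[OF ch] GU] \<open>open (\<phi> ` G)\<close>
      by (auto intro: continuous_open_preimage)
    moreover have "x \<in> \<phi> ` G \<inter> \<psi> -` ball (\<psi> x) (\<delta> / 2)" using x \<open>0 < \<delta>\<close> by simp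
    ultimately obtain s where "0 < s" and s: "cball x s \<subseteq> \<phi> ` G \<inter> \<psi> -` ball (\<psi> x) (\<delta> / 2)"
      using open_contains_cball by blast
    define i where "i = (x, min s (d / 2))"
    have sub: "cball (fst i) (snd i) \<subseteq> cball x s" by (auto simp: i_def)
    have near: "dist (\<psi> x) y < \<delta> / 2" if "y \<in> F i" for y
      using that s sub unfolding F_def by (auto simp: subset_iff)
    have "dist y y' < \<delta>" if "y \<in> F i" "y' \<in> F i" for y y'
      using near[OF that(1)] near[OF that(2)] dist_triangle3[of y y' "\<psi> x"] by linarith
    then have "i \<in> I" using sub s \<open>0 < s\<close> \<open>0 < d\<close> by (auto simp: I_def i_def)
    then show ?thesis using \<open>0 < s\<close> \<open>0 < d\<close> by (intro exI[of _ i]) (auto simp: i_def)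
  qed
  obtain C where C: "countable C" "C \<subseteq> I"
    and disj: "pairwise (\<lambda>i j. disjnt (ball (fst i) (snd i)) (ball (fst j) (snd j))) C"
    and negl: "negligible (\<phi> ` G - (\<Union>i\<in>C. ball (fst i) (snd i)))"
    using Vitali_covering_theorem_balls[of "\<phi> ` G" I fst snd, OF fine] by blast
  have Isub: "cball (fst i) (snd i) \<subseteq> \<phi> ` U" "ball (fst i) (snd i) \<subseteq> \<phi> ` U" if "i \<in> I" for i
    using that GU ball_subset_cball[of "fst i" "snd i"] unfolding I_def by blast+
  have F_iff: "z \<in> F i \<longleftrightarrow> z \<in> U \<and> \<phi> z \<in> ball (fst i) (snd i)" if "i \<in> I" for i z
    unfolding F_def using chart_image_iff[OF ch Isub(2)[OF that]] .
  have openF: "open (F i)" if "i \<in> I" for i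
    unfolding F_def using Isub[OF that] by (intro chart_open_image[OF ch]) auto
  have clF: "closure (F i) \<subseteq> \<psi> ` cball (fst i) (snd i)" if "i \<in> I" for i
    unfolding F_def
    using Isub(1)[OF that]
    by (intro closure_minimal image_mono ball_subset_cball compact_imp_closed chart_compact_image[OF ch]) auto
  have clFG: "closure (F i) \<subseteq> G" if "i \<in> I" for i
  proof
    fix z assume "z \<in> closure (F i)"
    then obtain y where "z = \<psi> y" "y \<in> cball (fst i) (snd i)" using clF[OF \<open>i \<in> I\<close>] by blast
    then obtain x where "z = \<psi> (\<phi> x)" "x \<in> G" using \<open>i \<in> I\<close> unfolding I_def by blast
    then show "z \<in> G" using chart_inverse(1)[OF ch] G(2) by auto
  qed
  have thin: "thin_cell m \<delta> (F i)" if i: "i \<in> I" for i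
    unfolding thin_cell_def
  proof (intro conjI)
    show "\<exists>c. cell c (F i)"
      unfolding F_def using cell_chart_ball[OF cpt ch _ Isub(1)[OF i]] i by (auto simp: I_def)
    show "\<forall>x\<in>F i. \<forall>y\<in>F i. dist x y < \<delta>" using i by (simp add: I_def)
    \<comment> \<open>The closure stays in the preimage of the closed ball, so the boundary has
      coordinates on a sphere, which is negligible.\<close>
    have "\<phi> ` (closure (F i) - F i) \<subseteq> sphere (fst i) (snd i)"
    proof clarify
      fix z assume "z \<in> closure (F i)" "z \<notin> F i"
      moreover have "z \<in> U \<and> \<phi> z \<in> cball (fst i) (snd i)"
        using clF[OF i] \<open>z \<in> closure (F i)\<close> chart_image_iff[OF ch Isub(1)[OF i]] by blast
      ultimately show "\<phi> z \<in> sphere (fst i) (snd i)" by (auto simp: F_iff[OF i])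
    qed
    then have "negligible (\<phi> ` (closure (F i) - F i))"
      using negligible_sphere negligible_subset by blast
    then show "measure m (closure (F i) - F i) = 0"
      using openF[OF i] clFG[OF i] G(2) by (intro nul) auto
  qed
  have zero: "measure m (G - (\<Union>i\<in>C. F i)) = 0"
  proof (rule nul)
    have "open (\<Union>i\<in>C. F i)" using openF C(2) by (intro open_UN) blast
    then show "G - (\<Union>i\<in>C. F i) \<in> sets borel" using G(1) by simp
    have "\<phi> ` (G - (\<Union>i\<in>C. F i)) \<subseteq> \<phi> ` G - (\<Union>i\<in>C. ball (fst i) (snd i))"
      using F_iff C(2) G(2) by blast
    then show "negligible (\<phi> ` (G - (\<Union>i\<in>C. F i)))"
      using negl negligible_subset by blast
  qed (use G(2) in blast)
  have "\<exists>J. finite J \<and> J \<subseteq> C \<and> measure m (G - (\<Union>i\<in>J. F i)) < \<epsilon>"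
  proof (cases "C = {}")
    case True
    then show ?thesis using zero \<open>0 < \<epsilon>\<close> by (intro exI[of _ "{}"]) simp
  next
    case False
    \<comment> \<open>An enumeration, possibly with repetitions; only the finite sets
      \<open>e\<close> applied to \<open>{..<n}\<close> are used in the end.\<close>
    define e where "e = from_nat_into C"
    have e: "range e = C" using range_from_nat_into[OF False C(1)] by (simp add: e_def)
    have "(\<lambda>n. measure m (G - (\<Union>k<n. F (e k)))) \<longlonglongrightarrow> measure m (\<Inter>n. G - (\<Union>k<n. F (e k)))"
    proof (rule finite_Lim_measure_decseq)
      have "open (F (e k))" for k using openF e C(2) by blast
      then have "open (\<Union>k<n. F (e k))" for n by auto
      then show "range (\<lambda>n. G - (\<Union>k<n. F (e k))) \<subseteq> sets m"
        using G(1) by (auto simp: borel)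
      show "decseq (\<lambda>n. G - (\<Union>k<n. F (e k)))"
        by (auto simp: decseq_def)
    qed
    also have "(\<Inter>n. G - (\<Union>k<n. F (e k))) = G - (\<Union>i\<in>C. F i)"
      unfolding e[symmetric] by auto
    finally have "(\<lambda>n. measure m (G - (\<Union>k<n. F (e k)))) \<longlonglongrightarrow> 0" by (simp add: zero)
    then have "\<forall>\<^sub>F n in sequentially. measure m (G - (\<Union>k<n. F (e k))) < \<epsilon>"
      using \<open>0 < \<epsilon>\<close> by (rule order_tendstoD)
    then obtain n where "measure m (G - (\<Union>k<n. F (e k))) < \<epsilon>"
      by (auto simp: eventually_sequentially)
    then show ?thesis using e by (intro exI[of _ "e ` {..<n}"]) auto
  qed
  then obtain J where J: "finite J" "J \<subseteq> C" "measure m (G - (\<Union>i\<in>J. F i)) < \<epsilon>" by blast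
  show ?thesis
  proof (intro exI[of _ "F ` J"] conjI)
    show "\<forall>D\<in>F ` J. thin_cell m \<delta> D \<and> closure D \<subseteq> G"
      using J(2) C(2) thin clFG by blast
    show "disjoint (F ` J)"
      unfolding pairwise_image
    proof (rule pairwiseI)
      fix i j assume ij: "i \<in> J" "j \<in> J" "i \<noteq> j"
      then have "disjnt (ball (fst i) (snd i)) (ball (fst j) (snd j))"
        using disj J(2) unfolding pairwise_def by blast
      moreover have "i \<in> I" "j \<in> I" using ij J(2) C(2) by auto
      ultimately show "F i \<noteq> F j \<longrightarrow> disjnt (F i) (F j)"
        by (auto simp: disjnt_iff F_iff)
    qed
  qed (use J in auto)
qed

text \<open>Overlapping charts are handled one at a time: each chart is only asked to fill the open
  set left after removing the closures of the earlier cells, which makes new cells disjoint from old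
  ones.\<close>

lemma thin_cells_cover_charts:
  fixes m :: "'a::metric_space measure"
  assumes cpt: "compact (UNIV :: 'a set)" and fin: "finite_measure m" and borel: "sets m = sets borel"
    and "finite \<U>" and "\<And>U. U \<in> \<U> \<Longrightarrow> \<exists>(\<phi>::'a \<Rightarrow> 'e::euclidean_space) \<psi>. chart U \<phi> \<psi> \<and> chart_null m U \<phi>"
    and "0 < \<delta>" and "0 < \<epsilon>"
  shows "\<exists>\<D>. finite \<D> \<and> disjoint \<D> \<and> (\<forall>D\<in>\<D>. thin_cell m \<delta> D) \<and> measure m (\<Union>\<U> - \<Union>\<D>) < \<epsilon>"
  using assms(4,5,7)
proof (induction \<U> arbitrary: \<epsilon> rule: finite_induct)
  case empty
  then show ?case by (intro exI[of _ "{}"]) simp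
next
  case (insert U \<U>)
  interpret finite_measure m by (rule fin)
  obtain \<D> where \<D>: "finite \<D>" "disjoint \<D>" "\<And>D. D \<in> \<D> \<Longrightarrow> thin_cell m \<delta> D"
    "measure m (\<Union>\<U> - \<Union>\<D>) < \<epsilon> / 2"
    using insert.IH[of "\<epsilon> / 2"] insert.prems by (metis half_gt_zero insertCI)
  obtain \<psi> and \<phi> :: "'a \<Rightarrow> 'e" where ch: "chart U \<phi> \<psi>" and null: "chart_null m U \<phi>"
    using insert.prems(1) by blast
  define G where "G = U - (\<Union>D\<in>\<D>. closure D)"
  have "open G" unfolding G_def using \<D>(1) ch by (auto simp: chart_def intro!: open_Diff)
  then obtain \<D>' where \<D>': "finite \<D>'" "disjoint \<D>'"
    "\<And>D. D \<in> \<D>' \<Longrightarrow> thin_cell m \<delta> D" "\<And>D. D \<in> \<D>' \<Longrightarrow> closure D \<subseteq> G" "measure m (G - \<Union>\<D>') < \<epsilon> / 2"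
    using thin_cells_cover_chart[OF cpt ch fin borel null, of G \<delta> "\<epsilon> / 2"] \<open>0 < \<delta>\<close> insert.prems(2)
    by (auto simp: G_def)
  have op: "open D" if "D \<in> \<D> \<union> \<D>'" for D
    using that \<D>(3) \<D>'(3) by (auto simp: thin_cell_def cell_def)
  have opU: "open V" if "V \<in> \<U>" for V
    using insert.prems(1)[of V] that by (auto simp: chart_def)
  have sets: "\<Union>\<U> - \<Union>\<D> \<in> sets m" "G - \<Union>\<D>' \<in> sets m" "\<And>D. D \<in> \<D> \<Longrightarrow> closure D - D \<in> sets m"
  proof -
    have "open (\<Union>\<U>)" "open (\<Union>\<D>)" "open (\<Union>\<D>')" using op opU by auto
    then show "\<Union>\<U> - \<Union>\<D> \<in> sets m" "G - \<Union>\<D>' \<in> sets m" using \<open>open G\<close> by (simp_all add: borel)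
    show "closure D - D \<in> sets m" if "D \<in> \<D>" for D using op[of D] that by (simp add: borel)
  qed
  let ?N = "\<Union>D\<in>\<D>. closure D - D"
  have "measure m ?N \<le> (\<Sum>D\<in>\<D>. measure m (closure D - D))"
    using sets(3) \<D>(1) by (intro finite_measure_subadditive_finite) auto
  also have "\<dots> = 0" using \<D>(3) by (simp add: thin_cell_def)
  finally have N0: "measure m ?N \<le> 0" .
  have Nsets: "?N \<in> sets m" using sets(3) \<D>(1) by (intro sets.finite_UN) auto
  show ?case
  proof (intro exI[of _ "\<D> \<union> \<D>'"] conjI ballI)
    have "disjnt D D'" if "D \<in> \<D>" "D' \<in> \<D>'" for D D'
      using \<D>'(4)[OF that(2)] that(1) closure_subset[of D] closure_subset[of D']
      by (auto simp: G_def disjnt_iff)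
    then show "disjoint (\<D> \<union> \<D>')"
      using \<D>(2) \<D>'(2) by (auto simp: pairwise_def disjnt_sym)
    \<comment> \<open>An uncovered point of \<open>U\<close> is either outside all closures, hence
      in \<open>G\<close>, or on the boundary of an earlier cell, hence in the null set.\<close>
    have "\<Union>(insert U \<U>) - \<Union>(\<D> \<union> \<D>') \<subseteq> ((\<Union>\<U> - \<Union>\<D>) \<union> (G - \<Union>\<D>')) \<union> ?N"
      by (auto simp: G_def)
    then have "measure m (\<Union>(insert U \<U>) - \<Union>(\<D> \<union> \<D>')) \<le> measure m (((\<Union>\<U> - \<Union>\<D>) \<union> (G - \<Union>\<D>')) \<union> ?N)"
      using sets(1,2) Nsets by (intro finite_measure_mono) auto
    also have "\<dots> \<le> measure m ((\<Union>\<U> - \<Union>\<D>) \<union> (G - \<Union>\<D>')) + measure m ?N"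
      using sets(1,2) Nsets by (intro measure_Un_le) auto
    also have "\<dots> \<le> measure m (\<Union>\<U> - \<Union>\<D>) + measure m (G - \<Union>\<D>') + measure m ?N"
      using measure_Un_le[OF sets(1,2)] by simp
    finally show "measure m (\<Union>(insert U \<U>) - \<Union>(\<D> \<union> \<D>')) < \<epsilon>"
      using \<D>(4) \<D>'(5) N0 by simp
  qed (use \<D> \<D>' in auto)
qed

lemma open_inner_compact:
  fixes m :: "'a::metric_space measure"
  assumes cpt: "compact (UNIV :: 'a set)" and fin: "finite_measure m" and borel: "sets m = sets borel"
    and "open G" and "0 < \<epsilon>"
  shows "\<exists>K. compact K \<and> K \<subseteq> G \<and> measure m (G - K) < \<epsilon>"
proof (cases "G = UNIV")
  case True
  then show ?thesis using cpt \<open>0 < \<epsilon>\<close> by (intro exI[of _ UNIV]) simp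
next
  case False
  interpret finite_measure m by (rule fin)
  \<comment> \<open>For \<open>G = UNIV\<close> the complement is empty and \<open>infdist\<close>
    takes its default value 0, which would make every \<open>K n\<close> empty; hence the separate
    case above.\<close>
  define K where "K n = {x. 1 / real (Suc n) \<le> infdist x (- G)}" for n
  have "closed (K n)" for n
    unfolding K_def by (intro closed_Collect_le continuous_intros)
  have "K n \<subseteq> G" for n
  proof
    fix x assume "x \<in> K n"
    then have "infdist x (- G) > 0"
      unfolding K_def using less_le_trans[of 0 "1 / real (Suc n)"] by simp
    then show "x \<in> G" using infdist_zero[of x "- G"] by (cases "x \<in> G") simp_all
  qed
  have "(\<lambda>n. measure m (G - K n)) \<longlonglongrightarrow> measure m (\<Inter>n. G - K n)"
  proof (rule finite_Lim_measure_decseq)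
    show "range (\<lambda>n. G - K n) \<subseteq> sets m"
      using \<open>open G\<close> \<open>\<And>n. closed (K n)\<close> by (auto simp: borel)
    have "K i \<subseteq> K j" if "i \<le> j" for i j
    proof -
      have "1 / real (Suc j) \<le> 1 / real (Suc i)" using that by (simp add: frac_le)
      then show ?thesis by (auto simp: K_def)
    qed
    then show "decseq (\<lambda>n. G - K n)" by (auto simp: decseq_def)
  qed
  also have "(\<Inter>n. G - K n) = {}"
  proof -
    have "\<exists>n. x \<in> K n" if "x \<in> G" for x
    proof -
      have "infdist x (- G) \<noteq> 0"
        using in_closed_iff_infdist_zero[of "- G" x] \<open>open G\<close> False that by auto
      then have "0 < infdist x (- G)" using infdist_nonneg[of x "- G"] by linarith
      then obtain n where "1 / real (Suc n) < infdist x (- G)" using nat_approx_posE by blast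
      then show ?thesis by (auto simp: K_def intro: less_imp_le)
    qed
    then show ?thesis by blast
  qed
  finally have "(\<lambda>n. measure m (G - K n)) \<longlonglongrightarrow> 0" by simp
  then have "\<forall>\<^sub>F n in sequentially. measure m (G - K n) < \<epsilon>"
    using \<open>0 < \<epsilon>\<close> by (rule order_tendstoD)
  then obtain n where "measure m (G - K n) < \<epsilon>" by (auto simp: eventually_sequentially)
  then show ?thesis
    using \<open>K n \<subseteq> G\<close> compact_Int_closed[OF cpt \<open>closed (K n)\<close>] by (intro exI[of _ "K n"]) simp
qed

section \<open>Genericity\<close>

text \<open>Lower semicontinuity of the measure of the trapped set. The sets \<open>S i\<close> of
  points that are stably trapped under all perturbations of size \<open>1 / real (Suc i)\<close>
  increase to the trapped set of \<open>f\<close>, so one of them already has measure above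
  \<open>c\<close>. Taking interiors makes them Borel.\<close>

lemma trapped_measure_open:
  fixes f :: "'a::metric_space \<Rightarrow> 'a"
  assumes cpt: "compact (UNIV :: 'a set)" and fin: "finite_measure m" and borel: "sets m = sets borel"
    and f: "continuous_on UNIV f" and c: "c < measure m {x. trapped \<epsilon> f x}"
  shows "\<exists>r>0. \<forall>g. continuous_on UNIV g \<and> C0_dist f g < r \<longrightarrow> c < measure m {x. trapped \<epsilon> g x}"
proof -
  interpret finite_measure m by (rule fin)
  define S where "S i = interior {x. \<forall>g. C0_dist f g < 1 / real (Suc i) \<longrightarrow> trapped \<epsilon> g x}" for i
  have S_trapped: "S i \<subseteq> {x. trapped \<epsilon> g x}" if "C0_dist f g < 1 / real (Suc i)" for i g
    using that interior_subset unfolding S_def by blast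
  have "(\<lambda>i. measure m (S i)) \<longlonglongrightarrow> measure m (\<Union>i. S i)"
  proof (rule finite_Lim_measure_incseq)
    show "range S \<subseteq> sets m" by (auto simp: borel S_def)
    have "1 / real (Suc j) \<le> 1 / real (Suc i)" if "i \<le> j" for i j
      using that by (simp add: frac_le)
    then show "incseq S"
      unfolding S_def by (intro incseq_def[THEN iffD2] allI impI interior_mono) (use less_le_trans in blast)
  qed
  also have "(\<Union>i. S i) = {x. trapped \<epsilon> f x}"
  proof
    show "(\<Union>i. S i) \<subseteq> {x. trapped \<epsilon> f x}" using S_trapped[of f] by auto
    show "{x. trapped \<epsilon> f x} \<subseteq> (\<Union>i. S i)"
    proof clarify
      fix x assume "trapped \<epsilon> f x"
      from trapped_open[OF cpt f this] obtain r where "0 < r"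
        and r: "\<And>g y. C0_dist f g < r \<Longrightarrow> dist x y < r \<Longrightarrow> trapped \<epsilon> g y" by blast
      obtain i where i: "1 / real (Suc i) < r" using nat_approx_posE[OF \<open>0 < r\<close>] by blast
      have "ball x r \<subseteq> {x. \<forall>g. C0_dist f g < 1 / real (Suc i) \<longrightarrow> trapped \<epsilon> g x}"
        using r i by auto
      then have "ball x r \<subseteq> S i" unfolding S_def by (simp add: interior_maximal)
      then show "x \<in> (\<Union>i. S i)" using \<open>0 < r\<close> by (intro UN_I[of i]) auto
    qed
  qed
  finally have "\<forall>\<^sub>F i in sequentially. c < measure m (S i)"
    using c by (rule order_tendstoD)
  then obtain i where i: "c < measure m (S i)" by (auto simp: eventually_sequentially)
  show ?thesis
  proof (intro exI[of _ "1 / real (Suc i)"] conjI allI impI)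
    fix g :: "'a \<Rightarrow> 'a" assume g: "continuous_on UNIV g \<and> C0_dist f g < 1 / real (Suc i)"
    have "measure m (S i) \<le> measure m {x. trapped \<epsilon> g x}"
      using S_trapped[of g i] g open_trapped[OF cpt, of g \<epsilon>]
      by (intro finite_measure_mono) (auto simp: borel)
    then show "c < measure m {x. trapped \<epsilon> g x}" using i by simp
  qed simp
qed

lemma trapped_measure_dense:
  fixes f :: "'a::metric_space \<Rightarrow> 'a"
  assumes cpt: "compact (UNIV :: 'a set)" and cells: "small_cells_everywhere TYPE('a)"
    and fin: "finite_measure m" and borel: "sets m = sets borel"
    and cover: "\<And>\<delta> \<kappa>. 0 < \<delta> \<Longrightarrow> 0 < \<kappa> \<Longrightarrow>
      \<exists>\<D>. finite \<D> \<and> disjoint \<D> \<and> (\<forall>D\<in>\<D>. thin_cell m \<delta> D) \<and> measure m (UNIV - \<Union>\<D>) < \<kappa>"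
    and f: "f \<in> Homeo" and "0 < \<epsilon>" and "0 < r" and "0 < \<kappa>"
  shows "\<exists>g\<in>Homeo. C0_dist f g < r \<and> measure m UNIV - \<kappa> < measure m {x. trapped \<epsilon> g x}"
proof -
  interpret finite_measure m by (rule fin)
  have "uniformly_continuous_on UNIV f"
    using compact_uniformly_continuous[OF Homeo_continuous[OF f] cpt] .
  then obtain d where "0 < d" and d: "\<And>x y. dist x y < d \<Longrightarrow> dist (f x) (f y) < r / 8"
    unfolding uniformly_continuous_on_def using \<open>0 < r\<close>
    by (metis UNIV_I divide_pos_pos dist_commute zero_less_numeral)
  \<comment> \<open>The bound \<open>d\<close> keeps \<open>f (h x)\<close> within
    \<open>r / 8\<close> of \<open>f x\<close>, and \<open>r / 8\<close> bounds the displacement by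
    \<open>k\<close>; with the distance from \<open>f\<close> to \<open>g1\<close> this makes three
    errors below \<open>r / 8\<close>. The bound \<open>\<epsilon> / 4\<close> pays for the
    conjugation, which turns level \<open>\<epsilon> / 2\<close> into \<epsilon>.\<close>
  define \<delta> where "\<delta> = Min {d, r / 8, \<epsilon> / 4}"
  have \<delta>: "0 < \<delta>" "\<delta> \<le> d" "\<delta> \<le> r / 8" "\<delta> \<le> \<epsilon> / 4"
    using \<open>0 < d\<close> \<open>0 < r\<close> \<open>0 < \<epsilon>\<close> by (auto simp: \<delta>_def)
  obtain \<D> where \<D>: "finite \<D>" "disjoint \<D>" "\<And>D. D \<in> \<D> \<Longrightarrow> thin_cell m \<delta> D"
    "measure m (UNIV - \<Union>\<D>) < \<kappa> / 2"
    using cover[OF \<delta>(1), of "\<kappa> / 2"] \<open>0 < \<kappa>\<close> by (metis half_gt_zero)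
  obtain c where c: "\<And>D. D \<in> \<D> \<Longrightarrow> cell (c D) D"
    using \<D>(3) unfolding thin_cell_def by metis
  have small: "dist x y < \<delta>" if "D \<in> \<D>" "x \<in> D" "y \<in> D" for D x y
    using \<D>(3)[OF that(1)] that(2,3) by (simp add: thin_cell_def)
  have opD: "open D" if "D \<in> \<D>" for D using c[OF that] by (simp add: cell_def)
  then have "open (\<Union>\<D>)" by auto
  obtain g1 where g1: "g1 \<in> Homeo" "C0_dist f g1 < r / 8" "\<And>p. p \<in> c ` \<D> \<Longrightarrow> trapped (\<epsilon> / 2) g1 p"
    using trapped_finite_dense[OF cpt cells f, of "\<epsilon> / 2" "r / 8" "c ` \<D>"] \<D>(1) \<open>0 < \<epsilon>\<close> \<open>0 < r\<close>
    by auto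
  define E where "E = {x. trapped (\<epsilon> / 2) g1 x}"
  have "open E" unfolding E_def by (rule open_trapped[OF cpt Homeo_continuous[OF g1(1)]])
  obtain K where K: "compact K" "K \<subseteq> \<Union>\<D>" "measure m (\<Union>\<D> - K) < \<kappa> / 2"
    using open_inner_compact[OF cpt fin borel \<open>open (\<Union>\<D>)\<close>, of "\<kappa> / 2"] \<open>0 < \<kappa>\<close> by auto
  have KD: "compact (K \<inter> D) \<and> K \<inter> D \<subseteq> D \<and> c D \<in> E" if "D \<in> \<D>" for D
  proof -
    \<comment> \<open>Since \<open>K\<close> is covered by disjoint open cells, its part in one of
      them is obtained by removing the others, hence closed.\<close>
    have "K \<inter> D = K \<inter> (- \<Union>(\<D> - {D}))"
      using \<D>(2) K(2) that by (fastforce simp: pairwise_def disjnt_iff)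
    moreover have "closed (- \<Union>(\<D> - {D}))" using opD by auto
    ultimately have "compact (K \<inter> D)" using compact_Int_closed[OF K(1)] by simp
    then show ?thesis using that g1(3) by (auto simp: E_def)
  qed
  have "\<exists>h k. homeomorphism UNIV UNIV h k \<and> (\<forall>x. x \<notin> \<Union>\<D> \<longrightarrow> h x = x) \<and>
      (\<forall>D\<in>\<D>. h ` D \<subseteq> D \<and> h ` (K \<inter> D) \<subseteq> E)"
    by (rule squeeze_into_open[where K = "\<lambda>D. K \<inter> D", OF \<D>(1,2) c KD \<open>open E\<close>])
  then obtain h k where hk: "homeomorphism UNIV UNIV h k" and h: "\<forall>x. x \<notin> \<Union>\<D> \<longrightarrow> h x = x"
    "\<forall>D\<in>\<D>. h ` D \<subseteq> D \<and> h ` (K \<inter> D) \<subseteq> E"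
    by (elim exE conjE)
  have hk': "h (k x) = x" "k (h x) = x" for x
    using hk by (auto simp: homeomorphism_def)
  have disp_h: "dist x (h x) < \<delta>" for x
  proof (cases "x \<in> \<Union>\<D>")
    case True
    then obtain D where "D \<in> \<D>" "x \<in> D" by blast
    then show ?thesis using h(2) small[of D x "h x"] by blast
  qed (use h(1) \<delta>(1) in simp)
  have disp_k: "dist x (k x) < \<delta>" for x
    using disp_h[of "k x"] by (simp add: hk' dist_commute)
  define g where "g = k \<circ> g1 \<circ> h"
  obtain g1' where "homeomorphism UNIV UNIV g1 g1'" using g1(1) by (auto simp: Homeo_def)
  then have "homeomorphism UNIV UNIV g (k \<circ> (g1' \<circ> h))"
    unfolding g_def comp_assoc
    using homeomorphism_compose[OF homeomorphism_compose[OF hk] homeomorphism_symD[OF hk]]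
    by (simp add: comp_assoc)
  then have "g \<in> Homeo" by (auto simp: Homeo_def)
  moreover have "C0_dist f g < r"
  proof -
    have "dist (f x) (g x) \<le> r / 2" for x
    proof -
      have "dist (f x) (f (h x)) < r / 8" using d disp_h[of x] \<delta>(2) by simp
      moreover have "dist (f (h x)) (g1 (h x)) < r / 8"
        using C0_dist_upper[OF cpt, of f "h x" g1] g1(2) by simp
      moreover have "dist (g1 (h x)) (g x) < r / 8"
        using disp_k[of "g1 (h x)"] \<delta>(3) by (simp add: g_def)
      moreover have "dist (f x) (g x) \<le> dist (f x) (f (h x)) + dist (f (h x)) (g1 (h x)) + dist (g1 (h x)) (g x)"
        by metric
      ultimately show ?thesis using \<open>0 < r\<close> by linarith
    qed
    then have "C0_dist f g \<le> r / 2" by (rule C0_dist_le)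
    then show ?thesis using \<open>0 < r\<close> by simp
  qed
  moreover have "measure m UNIV - \<kappa> < measure m {x. trapped \<epsilon> g x}"
  proof -
    have "K \<subseteq> {x. trapped \<epsilon> g x}"
    proof clarify
      fix x assume "x \<in> K"
      then obtain D where "D \<in> \<D>" "x \<in> K \<inter> D" using K(2) by blast
      then have "trapped (\<epsilon> / 2) g1 (h x)" using h(2) by (auto simp: E_def)
      then have "trapped (\<epsilon> / 2 + 2 * (\<epsilon> / 4)) (k \<circ> g1 \<circ> h) x"
        using order_trans[OF less_imp_le[OF disp_k] \<delta>(4)] by (intro trapped_conjugate[OF cpt hk])
      then show "trapped \<epsilon> g x" by (simp add: g_def)
    qed
    moreover have "{x. trapped \<epsilon> g x} \<in> sets m"
      using open_trapped[OF cpt Homeo_continuous[OF \<open>g \<in> Homeo\<close>]] by (simp add: borel)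
    ultimately have "measure m K \<le> measure m {x. trapped \<epsilon> g x}"
      by (rule finite_measure_mono)
    moreover have "measure m UNIV \<le> measure m (UNIV - \<Union>\<D>) + measure m (\<Union>\<D> - K) + measure m K"
    proof -
      have [measurable]: "UNIV - \<Union>\<D> \<in> sets m" "\<Union>\<D> - K \<in> sets m" "K \<in> sets m"
        using \<open>open (\<Union>\<D>)\<close> compact_imp_closed[OF K(1)] by (auto simp: borel)
      have "UNIV = ((UNIV - \<Union>\<D>) \<union> (\<Union>\<D> - K)) \<union> K" by blast
      then have "measure m UNIV \<le> measure m ((UNIV - \<Union>\<D>) \<union> (\<Union>\<D> - K)) + measure m K"
        using measure_Un_le[of "(UNIV - \<Union>\<D>) \<union> (\<Union>\<D> - K)" m K] by simp
      then show ?thesis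
        using measure_Un_le[of "UNIV - \<Union>\<D>" m "\<Union>\<D> - K"] by simp
    qed
    ultimately show ?thesis using \<D>(4) K(3) by linarith
  qed
  ultimately show ?thesis by blast
qed

text \<open>The image of \<open>B\<close> is a null set of the completed Lebesgue measure. Passing
  to an almost-everywhere statement moves this to \<open>lborel\<close> without asking that the
  image be Borel.\<close>

lemma chart_null_density:
  fixes m :: "'a::metric_space measure" and \<phi> :: "'a \<Rightarrow> 'e::euclidean_space"
  assumes "\<And>B. B \<in> sets borel \<Longrightarrow> B \<subseteq> U \<Longrightarrow>
    emeasure m B = (\<integral>\<^sup>+y\<in>\<phi> ` B. ennreal (\<rho> y) \<partial>lborel)"
  shows "chart_null m U \<phi>"
  unfolding chart_null_def
proof (intro ballI impI)
  fix B :: "'a set" assume B: "B \<in> sets borel" "B \<subseteq> U" "negligible (\<phi> ` B)"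
  then have "AE y in lborel. y \<notin> \<phi> ` B"
    using AE_not_in[of "\<phi> ` B" lebesgue] by (simp add: negligible_iff_null_sets AE_completion_iff)
  then have "(\<integral>\<^sup>+y\<in>\<phi> ` B. ennreal (\<rho> y) \<partial>lborel) = (\<integral>\<^sup>+y. 0 \<partial>(lborel :: 'e measure))"
    by (intro nn_integral_cong_AE) (auto elim: eventually_mono)
  then show "measure m B = 0" using assms[OF B(1,2)] by (simp add: measure_def)
qed

text \<open>Nonemptiness of the family keeps its intersection inside the space, since the empty
  intersection is \<open>UNIV\<close>.\<close>

lemma residual_in_countable_Inter:
  assumes "countable \<U>" "\<U> \<noteq> {}"
    "\<And>U. U \<in> \<U> \<Longrightarrow> openin X U \<and> X closure_of U = topspace X"
  shows "residual_in X (\<Inter>\<U>)"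
  unfolding residual_in_def
proof (intro conjI exI[of _ \<U>] ballI)
  show "\<Inter>\<U> \<subseteq> topspace X" using assms(2,3) openin_subset by blast
qed (use assms in auto)

lemma generic_trapped:
  fixes m :: "'a::metric_space measure"
  assumes cpt: "compact (UNIV :: 'a set)" and cells: "small_cells_everywhere TYPE('a)"
    and m: "prob_space m" and borel: "sets m = sets borel"
    and cover: "\<And>\<delta> \<kappa>. 0 < \<delta> \<Longrightarrow> 0 < \<kappa> \<Longrightarrow>
      \<exists>\<D>. finite \<D> \<and> disjoint \<D> \<and> (\<forall>D\<in>\<D>. thin_cell m \<delta> D) \<and> measure m (UNIV - \<Union>\<D>) < \<kappa>"
  shows "\<exists>R. residual_in (Homeo_topology :: ('a \<Rightarrow> 'a) topology) R \<and>
    (\<forall>f\<in>R. AE x in m. \<forall>k. trapped (1 / real (Suc k)) f x)"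
proof -
  interpret prob_space m by (rule m)
  have space: "space m = UNIV" using sets_eq_imp_space_eq[OF borel] by simp
  have one: "measure m UNIV = 1" using prob_space space by simp
  interpret H: Metric_space "Homeo :: ('a \<Rightarrow> 'a) set" C0_dist
    by (rule Metric_space_Homeo[OF cpt])
  \<comment> \<open>Index \<open>k\<close> is the scale of trapping and \<open>l\<close> the measure
    allowed to escape. Intersecting over \<open>l\<close> makes the trapped set of each scale have
    full measure; intersecting over the countably many \<open>k\<close> keeps a single null
    set.\<close>
  define Q where "Q = (\<lambda>(k, l). {f \<in> Homeo. 1 - 1 / real (Suc l) < measure m {x. trapped (1 / real (Suc k)) f x}})"
  have Q: "openin Homeo_topology (Q p) \<and> Homeo_topology closure_of (Q p) = topspace Homeo_topology" for p
  proof
    obtain k l where p: "p = (k, l)" by (cases p)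
    show "openin Homeo_topology (Q p)"
      unfolding Homeo_topology_def H.openin_mtopology
    proof (intro conjI allI impI)
      fix f assume f: "f \<in> Q p"
      then obtain r where "0 < r" and r: "\<forall>g. continuous_on UNIV g \<and> C0_dist f g < r \<longrightarrow>
          1 - 1 / real (Suc l) < measure m {x. trapped (1 / real (Suc k)) g x}"
        using trapped_measure_open[OF cpt finite_measure_axioms borel Homeo_continuous, of f "1 - 1 / real (Suc l)"]
        by (auto simp: p Q_def)
      have "g \<in> Q p" if "g \<in> H.mball f r" for g
        using that r[rule_format, of g] Homeo_continuous[of g] by (simp add: p Q_def)
      then have "H.mball f r \<subseteq> Q p" by blast
      then show "\<exists>r>0. H.mball f r \<subseteq> Q p" using \<open>0 < r\<close> by blast
    qed (auto simp: p Q_def)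
    have "\<exists>g\<in>Q p. g \<in> H.mball f r" if "f \<in> Homeo" "0 < r" for f r
      using trapped_measure_dense[OF cpt cells finite_measure_axioms borel cover that(1) _ that(2),
          of "1 / real (Suc k)" "1 / real (Suc l)"] that(1)
      by (auto simp: p Q_def one)
    then show "Homeo_topology closure_of (Q p) = topspace Homeo_topology"
      unfolding Homeo_topology_def H.metric_closure_of H.topspace_mtopology by blast
  qed
  show ?thesis
  proof (intro exI[of _ "\<Inter>(range Q)"] conjI ballI)
    show "residual_in Homeo_topology (\<Inter>(range Q))"
      by (rule residual_in_countable_Inter) (use Q in auto)
    fix f assume "f \<in> \<Inter>(range Q)"
    then have fQ: "f \<in> Q (k, l)" for k l by blast
    then have f: "f \<in> Homeo" by (auto simp: Q_def)
    show "AE x in m. \<forall>k. trapped (1 / real (Suc k)) f x"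
      unfolding AE_all_countable
    proof
      fix k
      let ?E = "{x. trapped (1 / real (Suc k)) f x}"
      have "1 \<le> measure m ?E"
      proof (rule field_le_epsilon)
        fix e :: real assume "0 < e"
        then obtain l where "1 / real (Suc l) < e" using nat_approx_posE by blast
        then show "1 \<le> measure m ?E + e" using fQ[of k l] by (simp add: Q_def)
      qed
      moreover have "?E \<in> sets m"
        using open_trapped[OF cpt Homeo_continuous[OF f]] by (simp add: borel)
      ultimately have "AE x in m. x \<in> ?E"
        using prob_eq_1[of ?E] by (metis antisym prob_le_1)
      then show "AE x in m. trapped (1 / real (Suc k)) f x" by simp
    qed
  qed
qed

text \<open>A connected discrete space is a single point, so every sequence of values along an orbit
  is constant.\<close>

lemma generic_convergent_average_discrete:
  assumes "compact (UNIV :: 'a::metric_space set)" and "connected (UNIV :: 'a set)"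
    and "\<forall>x::'a. open {x}"
  shows "\<exists>R. residual_in (Homeo_topology :: ('a \<Rightarrow> 'a) topology) R \<and>
    (\<forall>f\<in>R. \<forall>\<phi>::'a \<Rightarrow> real. continuous_on UNIV \<phi> \<longrightarrow>
      (AE x in m. convergent (\<lambda>n. (1 / real n) * (\<Sum>k<n. \<phi> ((f ^^ k) x)))))"
proof -
  have single: "y = x" for x y :: 'a
  proof -
    have "openin (top_of_set UNIV) {x}" "closedin (top_of_set UNIV) {x}"
      using assms(3) by simp_all
    then have "{x} = UNIV"
      using assms(2) unfolding connected_clopen by (metis insert_not_empty)
    then show ?thesis by (metis UNIV_I singletonD)
  qed
  have conv: "convergent (\<lambda>n. (1 / real n) * (\<Sum>k<n. \<phi> ((f ^^ k) x)))"
    for f and \<phi> :: "'a \<Rightarrow> real" and x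
  proof (rule convergent_average_eventually_periodic[of 1])
    show "\<phi> ((f ^^ (k + 1)) x) = \<phi> ((f ^^ k) x)" for k
      using single[of "(f ^^ (k + 1)) x" "(f ^^ k) x"] by simp
  qed simp
  show ?thesis
  proof (intro exI[of _ Homeo] conjI ballI allI impI)
    show "residual_in Homeo_topology (Homeo :: ('a \<Rightarrow> 'a) set)"
      unfolding residual_in_def topspace_Homeo_topology[OF assms(1)]
      \<comment> \<open>The empty family of open dense sets shows that the whole space is
        residual.\<close>
      by (intro conjI exI[of _ "{}"]) auto
  qed (rule AE_I2, rule conv)
qed

text \<open>Compactness reduces the atlas to finitely many charts, as the covering by cells
  requires. The existence of cells and the absolute continuity of \<open>m\<close> are read off from
  the charts.\<close>

lemma generic_convergent_average_atlas:
  fixes A :: "('a::metric_space, 'e::euclidean_space) chart set"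
    and m :: "'a measure"
  assumes "compact (UNIV :: 'a set)" and atlas: "smooth_atlas A"
    and "volume_probability A m" and not_discrete: "\<not> (\<forall>x::'a. open {x})"
  shows "\<exists>R. residual_in (Homeo_topology :: ('a \<Rightarrow> 'a) topology) R \<and>
    (\<forall>f\<in>R. \<forall>\<phi>::'a \<Rightarrow> real. continuous_on UNIV \<phi> \<longrightarrow>
      (AE x in m. convergent (\<lambda>n. (1 / real n) * (\<Sum>k<n. \<phi> ((f ^^ k) x)))))"
proof -
  have m: "prob_space m" "sets m = sets borel" "smooth_positive_density A m"
    using assms(3) by (auto simp: volume_probability_def)
  have charts: "\<exists>\<psi>. chart U \<phi> \<psi>" "chart_null m U \<phi>" if "(U, \<phi>) \<in> A" for U \<phi>
  proof -
    show "\<exists>\<psi>. chart U \<phi> \<psi>"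
      using atlas that unfolding smooth_atlas_def chart_def by auto
    have "\<exists>\<rho>. smooth_on (\<phi> ` U) \<rho> \<and> (\<forall>y\<in>\<phi> ` U. \<rho> y > 0) \<and>
        (\<forall>B\<in>sets borel. B \<subseteq> U \<longrightarrow> emeasure m B = (\<integral>\<^sup>+y\<in>\<phi> ` B. ennreal (\<rho> y) \<partial>lborel))"
      using bspec[OF m(3)[unfolded smooth_positive_density_def if_not_P[OF not_discrete]] that]
      by (simp only: prod.case)
    then obtain \<rho> where
      "\<forall>B\<in>sets borel. B \<subseteq> U \<longrightarrow> emeasure m B = (\<integral>\<^sup>+y\<in>\<phi> ` B. ennreal (\<rho> y) \<partial>lborel)"
      by (elim exE conjE)
    then show "chart_null m U \<phi>" by (intro chart_null_density[where \<rho> = \<rho>]) auto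
  qed
  have UN: "\<Union>(fst ` A) = UNIV"
    using atlas by (simp add: smooth_atlas_def case_prod_unfold)
  have cells: "small_cells_everywhere TYPE('a)"
  proof (rule small_cells_everywhere_charts[OF assms(1)])
    fix z :: 'a
    have "z \<in> \<Union>(fst ` A)" by (simp add: UN)
    then obtain p where "p \<in> A" "z \<in> fst p" by blast
    then show "\<exists>U (\<phi>::'a \<Rightarrow> 'e) \<psi>. chart U \<phi> \<psi> \<and> z \<in> U"
      using charts(1)[of "fst p" "snd p"] by auto
  qed
  have chart_sets: "\<exists>\<phi>::'a \<Rightarrow> 'e. (\<exists>\<psi>. chart U \<phi> \<psi>) \<and> chart_null m U \<phi>" if U: "U \<in> fst ` A" for U
  proof -
    obtain p where "p \<in> A" "U = fst p" using U by blast
    then show ?thesis using charts[of "fst p" "snd p"] by auto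
  qed
  then have op: "open U" if "U \<in> fst ` A" for U
    using that unfolding chart_def by blast
  obtain \<U> where \<U>: "\<U> \<subseteq> fst ` A" "finite \<U>" "UNIV \<subseteq> \<Union>\<U>"
    by (rule compactE[OF assms(1), of "fst ` A"]) (use UN op in auto)
  have "\<exists>\<D>. finite \<D> \<and> disjoint \<D> \<and> (\<forall>D\<in>\<D>. thin_cell m \<delta> D) \<and> measure m (UNIV - \<Union>\<D>) < \<kappa>"
    if "0 < \<delta>" "0 < \<kappa>" for \<delta> \<kappa>
  proof -
    have "\<exists>(\<phi>::'a \<Rightarrow> 'e) \<psi>. chart U \<phi> \<psi> \<and> chart_null m U \<phi>" if "U \<in> \<U>" for U
      using chart_sets[of U] that \<U>(1) by blast
    from thin_cells_cover_charts[OF assms(1) prob_space.finite_measure[OF m(1)] m(2) \<U>(2) this that]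
    show ?thesis using \<U>(3) by (simp add: top.extremum_unique)
  qed
  from generic_trapped[OF assms(1) cells m(1,2) this]
  obtain R where R: "residual_in (Homeo_topology :: ('a \<Rightarrow> 'a) topology) R"
    "\<And>f. f \<in> R \<Longrightarrow> AE x in m. \<forall>k. trapped (1 / real (Suc k)) f x"
    by blast
  show ?thesis
  proof (intro exI[of _ R] conjI ballI allI impI)
    fix f and \<phi> :: "'a \<Rightarrow> real" assume "f \<in> R" and \<phi>: "continuous_on UNIV \<phi>"
    show "AE x in m. convergent (\<lambda>n. (1 / real n) * (\<Sum>k<n. \<phi> ((f ^^ k) x)))"
      using R(2)[OF \<open>f \<in> R\<close>]
      by (rule AE_mp) (use trapped_imp_convergent_average[OF assms(1) \<phi>] in auto)
  qed (rule R(1))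
qed

theorem mainTheorem1:
  fixes A :: "('a::metric_space, 'e::euclidean_space) chart set"
    and m :: "'a measure"
  assumes "compact (UNIV :: 'a set)"
    and "connected (UNIV :: 'a set)"
    and "smooth_manifold A"
    and "volume_probability A m"
  shows "\<exists>R. residual_in (Homeo_topology :: ('a \<Rightarrow> 'a) topology) R \<and>
    (\<forall>f\<in>R. \<forall>\<phi>::'a \<Rightarrow> real. continuous_on UNIV \<phi> \<longrightarrow>
      (AE x in m. convergent (\<lambda>n. (1 / real n) * (\<Sum>k<n. \<phi> ((f ^^ k) x)))))"
  using generic_convergent_average_discrete[OF assms(1,2)]
    generic_convergent_average_atlas[OF assms(1) _ assms(4)] assms(3)
  unfolding smooth_manifold_def by blast

end
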